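(* Let $n\ge 1$ and let $a_0,a_1,a_2,\dots\in Z(n)$ be the coefficients of the asymptotic expansion $\mathrm{Wg}_d(\mu)=\sum_{r\ge 0}\frac{a_r(\mu)}{d^{n+r}}$ (for all integers $d\ge n$ and all $\mu\vdash n$) of the unitary Weingarten function. Then for every $r\ge 0$, $$a_r=(-1)^r h_r(J_1,\dots,J_n)$$ as elements of $Z(n)$. Equivalently, for every $r\ge 0$, $$h_r(J_1,\dots,J_n)=(-1)^r\sum_{\mu\vdash n}a_r(\mu)\,\mathcal{C}_\mu .$$
   Context: $S(n)$ is the symmetric group on $\{1,\dots,n\}$ and $Z(n)$ is the center of the group algebra $\mathbb{C}[S(n)]$. An element $\sum_\sigma f(\sigma)\sigma$ of $Z(n)$ is identified with the function $f:S(n)\to\mathbb{C}$, constant on conjugacy classes; $f(\mu)$ denotes its value on permutations of cycle type $\mu$. For a partition $\mu\vdash n$, $\mathcal{C}_\mu\in Z(n)$ is the formal sum of all permutations in $S(n)$ of cycle type $\mu$; the $\mathcal{C}_\mu$ form the class basis of $Z(n)$, and $f=\sum_{\mu\vdash n}f(\mu)\mathcal{C}_\mu$. Jucys-Murphy elements: $J_1:=0$ and $J_i:=(1,i)+(2,i)+\dots+(i-1,i)\in\mathbb{C}[S(n)]$ for $2\le i\le n$. They commute pairwise. The complete homogeneous symmetric polynomials are $h_0:=1$ and $h_r(x_1,\dots,x_n):=\sum_{1\le i_1\le i_2\le\dots\le i_r\le n}x_{i_1}x_{i_2}\cdots x_{i_r}$ for $r\ge 1$. Symmetric polynomials in $J_1,\dots,J_n$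 lie in $Z(n)$. Weingarten function: for an integer $d\ge n$, $\mathrm{Wg}_d\in Z(n)$ is the central function $$\mathrm{Wg}_d(\sigma)=\int_{\mathbb{U}_d}u_{11}\cdots u_{nn}\,\overline{u}_{1\sigma(1)}\cdots\overline{u}_{n\sigma(n)}\,dU,\qquad \sigma\in S(n),$$ where $\mathbb{U}_d$ is the group of $d\times d$ unitary matrices $U=(u_{ij})$ and $dU$ is normalized Haar measure. A theorem of Collins states that for $d\ge n$, $\mathrm{Wg}_d$ is invertible in $Z(n)$ with $\mathrm{Wg}_d^{-1}=\sum_{\mu\vdash n}d^{\ell(\mu)}\mathcal{C}_\mu$, where $\ell(\mu)$ is the number of parts of $\mu$. Collins also showed that there exist central functions $a_0,a_1,\dots\in Z(n)$, independent of $d$, with $\mathrm{Wg}_d(\mu)=\sum_{r\ge 0}a_r(\mu)d^{-(n+r)}$ for all $\mu\vdash n$; this is called the asymptotic expansion of $\mathrm{Wg}_d$. *)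

theory Defs
  imports
    "HOL-Algebra.Sym_Groups"
    "HOL-Combinatorics.Orbits"
    "HOL-Probability.Probability"
    "Jordan_Normal_Form.Schur_Decomposition"
begin

section \<open>The group algebra of a finite group\<close>

text \<open>The element $\sum_x f(x)\,x$ is represented by its coefficient function \<open>f\<close>, which
  vanishes off the carrier of the group. The product is convolution. Meant for finite groups only.\<close>

definition group_algebra :: "('g, 'm) monoid_scheme \<Rightarrow> ('g \<Rightarrow> complex) ring" where
  "group_algebra G = \<lparr>
     carrier = {f. \<forall>x. x \<notin> carrier G \<longrightarrow> f x = 0},
     mult = (\<lambda>f g x. \<Sum>(y, z) \<in> {(y, z). y \<in> carrier G \<and> z \<in> carrier G \<and> y \<otimes>\<^bsub>G\<^esub> z = x}. f y * g z),
     one = (\<lambda>x. of_bool (x = \<one>\<^bsub>G\<^esub>)),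
     zero = (\<lambda>x. 0),
     add = (\<lambda>f g x. f x + g x)\<rparr>"

definition centre :: "('a, 'm) monoid_scheme \<Rightarrow> 'a set" where
  "centre R = {z \<in> carrier R. \<forall>x \<in> carrier R. z \<otimes>\<^bsub>R\<^esub> x = x \<otimes>\<^bsub>R\<^esub> z}"

lemma group_algebra_mult_alt:
  assumes "finite (carrier G)"
  shows "(f \<otimes>\<^bsub>group_algebra G\<^esub> g) x =
    (\<Sum>y\<in>carrier G. \<Sum>z\<in>carrier G. f y * g z * of_bool (y \<otimes>\<^bsub>G\<^esub> z = x))"
proof -
  have "{(y, z). y \<in> carrier G \<and> z \<in> carrier G \<and> y \<otimes>\<^bsub>G\<^esub> z = x} =
    {p \<in> carrier G \<times> carrier G. fst p \<otimes>\<^bsub>G\<^esub> snd p = x}"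
    by auto
  then have "(f \<otimes>\<^bsub>group_algebra G\<^esub> g) x =
    (\<Sum>p \<in> {p \<in> carrier G \<times> carrier G. fst p \<otimes>\<^bsub>G\<^esub> snd p = x}. f (fst p) * g (snd p))"
    by (simp add: group_algebra_def case_prod_beta)
  also have "\<dots> = (\<Sum>p \<in> carrier G \<times> carrier G.
      if fst p \<otimes>\<^bsub>G\<^esub> snd p = x then f (fst p) * g (snd p) else 0)"
    using assms by (intro sum.inter_filter) auto
  also have "\<dots> = (\<Sum>p \<in> carrier G \<times> carrier G.
      f (fst p) * g (snd p) * of_bool (fst p \<otimes>\<^bsub>G\<^esub> snd p = x))"
    by (intro sum.cong) auto
  finally show ?thesis
    by (simp add: sum.cartesian_product case_prod_beta)
qed

lemma ring_group_algebra:
  assumes "group G" and fin: "finite (carrier G)"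
  shows "ring (group_algebra G)"
proof -
  interpret G: group G by fact
  let ?R = "group_algebra G"
  let ?C = "carrier G"
  note mult = group_algebra_mult_alt[OF fin]
  have closed: "f \<otimes>\<^bsub>?R\<^esub> g \<in> carrier ?R" for f g
    by (auto simp: mult group_algebra_def[of G] of_bool_def intro!: sum.neutral)
  have delta: "(\<Sum>u\<in>?C. h u * of_bool (y \<otimes>\<^bsub>G\<^esub> z = u)) = h (y \<otimes>\<^bsub>G\<^esub> z)"
    if "y \<in> ?C" "z \<in> ?C" for h :: "'a \<Rightarrow> complex" and y z
    using that fin by (simp add: of_bool_def if_distrib[of "\<lambda>t. _ * t"] sum.delta' cong: if_cong)
  have assoc: "(f \<otimes>\<^bsub>?R\<^esub> g) \<otimes>\<^bsub>?R\<^esub> h = f \<otimes>\<^bsub>?R\<^esub> (g \<otimes>\<^bsub>?R\<^esub> h)" for f g h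
  proof
    fix x
    have "((f \<otimes>\<^bsub>?R\<^esub> g) \<otimes>\<^bsub>?R\<^esub> h) x =
      (\<Sum>u\<in>?C. \<Sum>w\<in>?C. \<Sum>y\<in>?C. \<Sum>z\<in>?C.
         f y * g z * h w * of_bool (u \<otimes>\<^bsub>G\<^esub> w = x) * of_bool (y \<otimes>\<^bsub>G\<^esub> z = u))"
      by (simp add: mult sum_distrib_right sum_distrib_left mult_ac)
    also have "\<dots> = (\<Sum>w\<in>?C. \<Sum>y\<in>?C. \<Sum>z\<in>?C. \<Sum>u\<in>?C.
         f y * g z * h w * of_bool (u \<otimes>\<^bsub>G\<^esub> w = x) * of_bool (y \<otimes>\<^bsub>G\<^esub> z = u))"
      by (subst sum.swap, rule sum.cong[OF refl], subst sum.swap, rule sum.cong[OF refl],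
          rule sum.swap)
    also have "\<dots> = (\<Sum>w\<in>?C. \<Sum>y\<in>?C. \<Sum>z\<in>?C.
         f y * g z * h w * of_bool ((y \<otimes>\<^bsub>G\<^esub> z) \<otimes>\<^bsub>G\<^esub> w = x))"
      by (intro sum.cong refl delta)
    also have "\<dots> = (\<Sum>y\<in>?C. \<Sum>w\<in>?C. \<Sum>z\<in>?C.
         f y * g z * h w * of_bool ((y \<otimes>\<^bsub>G\<^esub> z) \<otimes>\<^bsub>G\<^esub> w = x))"
      by (rule sum.swap)
    also have "\<dots> = (\<Sum>y\<in>?C. \<Sum>z\<in>?C. \<Sum>w\<in>?C.
         f y * g z * h w * of_bool (y \<otimes>\<^bsub>G\<^esub> (z \<otimes>\<^bsub>G\<^esub> w) = x))"
      by (rule sum.cong[OF refl], subst sum.swap) (auto intro!: sum.cong simp: G.m_assoc)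
    also have "\<dots> = (\<Sum>y\<in>?C. \<Sum>z\<in>?C. \<Sum>w\<in>?C. \<Sum>u\<in>?C.
         f y * g z * h w * of_bool (y \<otimes>\<^bsub>G\<^esub> u = x) * of_bool (z \<otimes>\<^bsub>G\<^esub> w = u))"
      by (intro sum.cong refl delta[symmetric])
    also have "\<dots> = (\<Sum>y\<in>?C. \<Sum>u\<in>?C. \<Sum>z\<in>?C. \<Sum>w\<in>?C.
         f y * g z * h w * of_bool (y \<otimes>\<^bsub>G\<^esub> u = x) * of_bool (z \<otimes>\<^bsub>G\<^esub> w = u))"
      by (rule sum.cong[OF refl], subst (2) sum.swap, rule sum.cong[OF refl], rule sum.swap)
    also have "\<dots> = (f \<otimes>\<^bsub>?R\<^esub> (g \<otimes>\<^bsub>?R\<^esub> h)) x"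
      by (simp add: mult sum_distrib_right sum_distrib_left mult_ac)
    finally show "((f \<otimes>\<^bsub>?R\<^esub> g) \<otimes>\<^bsub>?R\<^esub> h) x = (f \<otimes>\<^bsub>?R\<^esub> (g \<otimes>\<^bsub>?R\<^esub> h)) x" .
  qed
  have one: "\<one>\<^bsub>?R\<^esub> \<otimes>\<^bsub>?R\<^esub> f = f" "f \<otimes>\<^bsub>?R\<^esub> \<one>\<^bsub>?R\<^esub> = f" if f: "f \<in> carrier ?R" for f
  proof -
    have one_apply: "\<one>\<^bsub>?R\<^esub> y = of_bool (y = \<one>\<^bsub>G\<^esub>)" for y
      by (simp add: group_algebra_def)
    have eq: "(\<Sum>z\<in>?C. f z * of_bool (z = x)) = f x" for x
      using f fin by (auto simp: group_algebra_def of_bool_def if_distrib[of "\<lambda>t. _ * t"]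
          sum.delta cong: if_cong)
    have "(\<one>\<^bsub>?R\<^esub> \<otimes>\<^bsub>?R\<^esub> f) x = (\<Sum>y\<in>?C. if y = \<one>\<^bsub>G\<^esub> then \<Sum>z\<in>?C. f z * of_bool (z = x) else 0)" for x
      unfolding mult one_apply by (intro sum.cong refl) (auto intro!: sum.cong)
    moreover have "(f \<otimes>\<^bsub>?R\<^esub> \<one>\<^bsub>?R\<^esub>) x = (\<Sum>z\<in>?C. if z = \<one>\<^bsub>G\<^esub> then \<Sum>y\<in>?C. f y * of_bool (y = x) else 0)" for x
      unfolding mult one_apply
      by (subst sum.swap, intro sum.cong refl) (auto intro!: sum.cong)
    ultimately show "\<one>\<^bsub>?R\<^esub> \<otimes>\<^bsub>?R\<^esub> f = f" "f \<otimes>\<^bsub>?R\<^esub> \<one>\<^bsub>?R\<^esub> = f"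
      using fin by (auto simp: eq sum.delta)
  qed
  show ?thesis
  proof (intro ringI abelian_groupI monoidI)
    fix f assume "f \<in> carrier ?R"
    then show "\<exists>g\<in>carrier ?R. g \<oplus>\<^bsub>?R\<^esub> f = \<zero>\<^bsub>?R\<^esub>"
      by (intro bexI[of _ "\<lambda>x. - f x"]) (auto simp: group_algebra_def)
  next
    fix f g h
    show "(f \<oplus>\<^bsub>?R\<^esub> g) \<otimes>\<^bsub>?R\<^esub> h = f \<otimes>\<^bsub>?R\<^esub> h \<oplus>\<^bsub>?R\<^esub> g \<otimes>\<^bsub>?R\<^esub> h"
      "h \<otimes>\<^bsub>?R\<^esub> (f \<oplus>\<^bsub>?R\<^esub> g) = h \<otimes>\<^bsub>?R\<^esub> f \<oplus>\<^bsub>?R\<^esub> h \<otimes>\<^bsub>?R\<^esub> g"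
      by (auto simp: group_algebra_def fun_eq_iff case_prod_beta algebra_simps sum.distrib)
  qed (use closed assoc one in \<open>auto simp: group_algebra_def\<close>)
qed

section \<open>Symmetric functions of the Jucys-Murphy elements\<close>

abbreviation sym_algebra :: "nat \<Rightarrow> ((nat \<Rightarrow> nat) \<Rightarrow> complex) ring" where
  "sym_algebra n \<equiv> group_algebra (sym_group n)"

text \<open>The sum of the transpositions $(k,i)$ with $1 \le k < i$; for \<open>i = 1\<close> it is empty.\<close>

definition jucys_murphy :: "nat \<Rightarrow> (nat \<Rightarrow> nat) \<Rightarrow> complex" where
  "jucys_murphy i = (\<lambda>\<sigma>. \<Sum>k\<in>{1..<i}. of_bool (\<sigma> = Transposition.transpose k i))"

text \<open>$h_r(x_1,\dots,x_n)$, evaluated in a ring that need not be commutative: the weakly increasing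
  index sequences $i_1 \le \dots \le i_r$ are the sorted lists of length \<open>r\<close>, and the factors are
  multiplied in this order.\<close>

definition complete_homogeneous :: "('a, 'm) ring_scheme \<Rightarrow> nat \<Rightarrow> nat \<Rightarrow> (nat \<Rightarrow> 'a) \<Rightarrow> 'a" where
  "complete_homogeneous R n r x =
     (\<Oplus>\<^bsub>R\<^esub>is \<in> {is. length is = r \<and> sorted is \<and> set is \<subseteq> {1..n}}.
        foldr (\<lambda>i y. x i \<otimes>\<^bsub>R\<^esub> y) is \<one>\<^bsub>R\<^esub>)"

section \<open>Cycle types and class functions\<close>

definition partitions :: "nat \<Rightarrow> nat multiset set" where
  "partitions n = {\<mu>. 0 \<notin># \<mu> \<and> sum_mset \<mu> = n}"

text \<open>Cycles, including fixed points, are the orbits of \<open>\<sigma>\<close> on \<open>{1..n}\<close>.\<close>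

definition cycle_type :: "nat \<Rightarrow> (nat \<Rightarrow> nat) \<Rightarrow> nat multiset" where
  "cycle_type n \<sigma> = image_mset card (mset_set (orbit \<sigma> ` {1..n}))"

definition class_sum :: "nat \<Rightarrow> nat multiset \<Rightarrow> (nat \<Rightarrow> nat) \<Rightarrow> complex" where
  "class_sum n \<mu> = (\<lambda>\<sigma>. of_bool (\<sigma> permutes {1..n} \<and> cycle_type n \<sigma> = \<mu>))"

text \<open>The value $f(\mu)$ of a central \<open>f\<close>: it does not depend on the chosen permutation, and
  every \<open>\<mu> \<in> partitions n\<close> is the cycle type of some permutation of \<open>{1..n}\<close>.\<close>

definition class_value :: "nat \<Rightarrow> ((nat \<Rightarrow> nat) \<Rightarrow> complex) \<Rightarrow> nat multiset \<Rightarrow> complex" where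
  "class_value n f \<mu> = f (SOME \<sigma>. \<sigma> permutes {1..n} \<and> cycle_type n \<sigma> = \<mu>)"

section \<open>Haar measure on the unitary group and the Weingarten function\<close>

definition unitary_group :: "nat \<Rightarrow> complex mat set" where
  "unitary_group d = {U \<in> carrier_mat d d. U * mat_adjoint U = 1\<^sub>m d \<and> mat_adjoint U * U = 1\<^sub>m d}"

text \<open>The type of matrices carries no topology; the Borel sets of the unitary group are pulled
  back from $\mathbb{C}^{d\times d}$ along the matrix entries.\<close>

definition unitary_borel :: "nat \<Rightarrow> complex mat measure" where
  "unitary_borel d = vimage_algebra (unitary_group d)
     (\<lambda>U. \<lambda>ij\<in>{..<d} \<times> {..<d}. U $$ ij) (\<Pi>\<^sub>M ij\<in>{..<d} \<times> {..<d}. borel)"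

text \<open>Left invariance suffices, since the group is compact; regularity is automatic for finite Borel
  measures on a compact metrisable space.\<close>

definition normalized_haar :: "nat \<Rightarrow> complex mat measure \<Rightarrow> bool" where
  "normalized_haar d M \<longleftrightarrow>
     prob_space M \<and> sets M = sets (unitary_borel d) \<and>
     (\<forall>V\<in>unitary_group d. distr M M (\<lambda>U. V * U) = M)"

text \<open>Matrices are indexed from 0 and permutations act on \<open>{1..n}\<close>, hence the shift by one:
  the entry $u_{ij}$ is \<open>U $$ (i - 1, j - 1)\<close>.\<close>

definition weingarten :: "nat \<Rightarrow> complex mat measure \<Rightarrow> (nat \<Rightarrow> nat) \<Rightarrow> complex" where
  "weingarten n M = (\<lambda>\<sigma>. if \<sigma> permutes {1..n}
     then LINT U|M. (\<Prod>i=1..n. U $$ (i - 1, i - 1)) * (\<Prod>i=1..n. cnj (U $$ (i - 1, \<sigma> i - 1)))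
     else 0)"

end

theory Submission
  imports Defs
begin

text \<open>
  The whole proof rests on one identity in the group algebra,
  \[ \mathrm{Wg}_m \cdot (d + J_m) = \mathrm{Wg}_{m-1}, \qquad 1 \le m \le d, \]
  where \<open>S(m - 1)\<close> is embedded in \<open>S(m)\<close> as the stabiliser of \<open>m\<close> and $\mathrm{Wg}_0$ is the unit.
  It holds because the columns of a unitary matrix are orthonormal: in the integral of $\mathrm{Wg}_m$
  give the last factors $u_{mm}\,\overline u_{m\sigma(m)}$ a free row index \<open>k\<close> and sum over \<open>k\<close>.
  The sum collapses to $\mathrm{Wg}_{m-1}(\sigma)$. The terms with \<open>k \<ge> m\<close> are all equal to
  $\mathrm{Wg}_m(\sigma)$, by an exchange of rows. A term with \<open>k < m\<close> has the row \<open>k\<close> twice, and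
  invariance of Haar measure under unitary mixing of the rows \<open>k\<close> and \<open>m\<close> turns it into
  $\mathrm{Wg}_m(\sigma) + \mathrm{Wg}_m(\sigma\,(k,m))$ (\<open>haar_integral_row_exchange\<close>). Adding up gives
  $d\,\mathrm{Wg}_m + \mathrm{Wg}_m J_m$ (\<open>weingarten_recurrence\<close>).

  Formally, then, $\mathrm{Wg}_n = (d + J_1)^{-1} \cdots (d + J_n)^{-1}$, and expanding the geometric series
  produces $\sum_r (-1)^r h_r(J_1,\dots,J_n)\,d^{-(n+r)}$ with the factors in weakly increasing order.
  No series is in fact expanded: the identity transforms any expansion of $\mathrm{Wg}_m$ into one of
  $\mathrm{Wg}_{m-1}$, whose coefficients are known by induction, and the recurrence
  $h_{r+1}(x_1,\dots,x_m) = h_{r+1}(x_1,\dots,x_{m-1}) + h_r(x_1,\dots,x_m)\,x_m$ determines the coefficients for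
  \<open>m\<close> from those for \<open>m - 1\<close> (\<open>weingarten_coefficients\<close>). The induction starts at \<open>m = 0\<close> with the
  uniqueness of power series in \<open>1/d\<close>.

  The expansion is given for one permutation of each cycle type. To have it for all permutations,
  $\mathrm{Wg}_n$ must be a class function. The same telescoping shows that the function
  $P_n(\sigma) = d^{\,\mathrm{cycles}(\sigma)}$ is $(d + J_n) \cdots (d + J_1)$, hence
  $\mathrm{Wg}_n \cdot P_n = 1$; since $P_n$ is central, so is its inverse (\<open>weingarten_central\<close>). That a central function
  is determined by its values on cycle types comes from the classification of conjugacy classes
  (\<open>conjugate_if_cycle_type_eq\<close>).
\<close>

section \<open>Cycle types and conjugacy\<close>

lemma funpow_eq_iff_mod_card_orbit:
  assumes "permutation f"
  shows "(f ^^ i) x = (f ^^ j) x \<longleftrightarrow> i mod card (orbit f x) = j mod card (orbit f x)"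
proof -
  let ?D = "funpow_dist1 f x x"
  have x: "x \<in> orbit f x"
    using assms by (rule permutation_self_in_orbit)
  have inj: "inj_on (\<lambda>n. (f ^^ n) x) {0..<?D}"
    by (rule inj_on_funpow_dist1[OF x])
  have D: "card (orbit f x) = ?D"
    by (subst orbit_conv_funpow_dist1[OF x]) (simp add: card_image[OF inj])
  have red: "(f ^^ (k mod ?D)) x = (f ^^ k) x" for k
    using funpow_mod_eq[OF funpow_dist1_prop[OF x]] .
  have "(f ^^ i) x = (f ^^ j) x \<longleftrightarrow> (f ^^ (i mod ?D)) x = (f ^^ (j mod ?D)) x"
    by (simp only: red)
  also have "\<dots> \<longleftrightarrow> i mod ?D = j mod ?D"
    by (rule inj_on_eq_iff[OF inj]) (auto simp del: funpow.simps)
  finally show ?thesis by (simp only: D)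
qed

text \<open>Equal multisets of values let the elements be paired off one by one. Applied to two sets of
  orbits with \<open>card\<close> on both sides, it matches cycles of equal length.\<close>

lemma ex_bij_betw_of_image_mset_eq:
  assumes "finite A" "finite B" and "image_mset f (mset_set A) = image_mset g (mset_set B)"
  shows "\<exists>h. bij_betw h A B \<and> (\<forall>x\<in>A. g (h x) = f x)"
  using assms
proof (induction A arbitrary: B rule: finite_induct)
  case empty
  then show ?case by (auto simp: mset_set_empty_iff bij_betw_def)
next
  case (insert x A)
  have "f x \<in># image_mset g (mset_set B)"
    using insert.hyps insert.prems(2)[symmetric] by simp
  then obtain y where y: "y \<in> B" "g y = f x"
    using insert.prems(1) by auto
  have "image_mset f (mset_set A) = image_mset g (mset_set (B - {y}))"
    using insert.hyps insert.prems y by (simp add: mset_set.remove[OF \<open>finite B\<close> \<open>y \<in> B\<close>])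
  with insert.IH[of "B - {y}"] insert.prems(1)
  obtain h where h: "bij_betw h A (B - {y})" "\<forall>z\<in>A. g (h z) = f z" by auto
  have "bij_betw (h(x := y)) A (B - {y})"
    using h(1) insert.hyps by (subst bij_betw_cong[of _ _ h]) auto
  then have "bij_betw (h(x := y)) (insert x A) (insert y (B - {y}))"
    using notIn_Un_bij_betw3[of x A "h(x := y)" "B - {y}"] insert.hyps by simp
  with h(2) y insert.hyps show ?case
    by (intro exI[of _ "h(x := y)"]) (auto simp: insert_absorb simp flip: fun_upd_def)
qed

text \<open>Once the orbits of \<open>\<sigma>\<close> are matched with orbits of \<open>\<tau>\<close> of the same size, choose a base point in
  every orbit and send $\sigma^i b$ to $\tau^i y$ for corresponding base points \<open>b\<close> and \<open>y\<close>. The sizes agree, so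
  this does not depend on \<open>i\<close>, and it intertwines \<open>\<sigma>\<close> and \<open>\<tau>\<close> by construction.\<close>

lemma conjugate_if_cycle_type_eq:
  assumes \<sigma>: "\<sigma> permutes {1..n}" and \<tau>: "\<tau> permutes {1..n}"
    and eq: "cycle_type n \<sigma> = cycle_type n \<tau>"
  shows "\<exists>\<pi>. \<pi> permutes {1..n} \<and> \<pi> \<circ> \<sigma> = \<tau> \<circ> \<pi>"
proof -
  have perm: "permutation \<sigma>" "permutation \<tau>"
    using \<sigma> \<tau> by (auto intro: permutation_permutes[THEN iffD2])
  obtain h where h: "bij_betw h (orbit \<sigma> ` {1..n}) (orbit \<tau> ` {1..n})"
    and card_h: "\<And>X. X \<in> orbit \<sigma> ` {1..n} \<Longrightarrow> card (h X) = card X"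
    using ex_bij_betw_of_image_mset_eq[OF _ _ eq[unfolded cycle_type_def]] by auto
  define y where "y X = (SOME z. z \<in> {1..n} \<and> orbit \<tau> z = h X)" for X
  have y: "y (orbit \<sigma> x) \<in> {1..n} \<and> orbit \<tau> (y (orbit \<sigma> x)) = h (orbit \<sigma> x)" if "x \<in> {1..n}" for x
    unfolding y_def
  proof (rule someI_ex)
    have "h (orbit \<sigma> x) \<in> orbit \<tau> ` {1..n}"
      using bij_betwE[OF h] that by blast
    then show "\<exists>z. z \<in> {1..n} \<and> orbit \<tau> z = h (orbit \<sigma> x)" by auto
  qed
  define b where "b X = (SOME z. z \<in> {1..n} \<and> orbit \<sigma> z = X)" for X
  have b: "b (orbit \<sigma> x) \<in> {1..n} \<and> orbit \<sigma> (b (orbit \<sigma> x)) = orbit \<sigma> x" if "x \<in> {1..n}" for x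
    unfolding b_def by (rule someI[of _ x]) (use that in auto)
  define \<pi> where "\<pi> x = (if x \<in> {1..n} then
      (\<tau> ^^ (SOME i. x = (\<sigma> ^^ i) (b (orbit \<sigma> x)))) (y (orbit \<sigma> x)) else x)" for x
  have orbit_pow: "orbit \<sigma> ((\<sigma> ^^ i) x) = orbit \<sigma> x" "orbit \<tau> ((\<tau> ^^ i) x) = orbit \<tau> x" for i x
    using permutation_orbit_step[OF perm(1)] permutation_orbit_step[OF perm(2)]
    by (induction i) auto
  have pow_in: "(\<sigma> ^^ i) x \<in> {1..n}" "(\<tau> ^^ i) x \<in> {1..n}" if "x \<in> {1..n}" for i x
    using that permutes_in_image[OF \<sigma>] permutes_in_image[OF \<tau>] by (induction i) auto
  have \<pi>_pow: "\<pi> ((\<sigma> ^^ i) (b (orbit \<sigma> x))) = (\<tau> ^^ i) (y (orbit \<sigma> x))" if x: "x \<in> {1..n}" for x i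
  proof -
    let ?O = "orbit \<sigma> x"
    let ?z = "(\<sigma> ^^ i) (b ?O)"
    have z: "?z \<in> {1..n}" "orbit \<sigma> ?z = ?O"
      using b[OF x] pow_in orbit_pow by auto
    define j where "j = (SOME j. ?z = (\<sigma> ^^ j) (b ?O))"
    have "?z = (\<sigma> ^^ j) (b ?O)"
      unfolding j_def by (rule someI[of _ i]) simp
    then have "i mod card ?O = j mod card ?O"
      using funpow_eq_iff_mod_card_orbit[OF perm(1)] b[OF x] by metis
    moreover have "card (orbit \<tau> (y ?O)) = card ?O"
      using card_h y[OF x] x by auto
    ultimately have "(\<tau> ^^ j) (y ?O) = (\<tau> ^^ i) (y ?O)"
      using funpow_eq_iff_mod_card_orbit[OF perm(2)] by metis
    then show ?thesis
      using z unfolding \<pi>_def by (simp add: j_def[symmetric])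
  qed
  have reach: "\<exists>i. x = (\<sigma> ^^ i) (b (orbit \<sigma> x))" if "x \<in> {1..n}" for x
  proof -
    have "x \<in> orbit \<sigma> (b (orbit \<sigma> x))"
      using b[OF that] permutation_self_in_orbit[OF perm(1)] by metis
    then show ?thesis
      by (auto simp: orbit_altdef_permutation[OF perm(1)])
  qed
  have comm: "\<pi> (\<sigma> x) = \<tau> (\<pi> x)" for x
  proof (cases "x \<in> {1..n}")
    case True
    from reach[OF this] obtain i where i: "x = (\<sigma> ^^ i) (b (orbit \<sigma> x))" ..
    have "\<pi> (\<sigma> x) = \<pi> ((\<sigma> ^^ Suc i) (b (orbit \<sigma> x)))"
      using i by simp
    also have "\<dots> = \<tau> (\<pi> ((\<sigma> ^^ i) (b (orbit \<sigma> x))))"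
      by (simp only: \<pi>_pow[OF True]) simp
    finally show ?thesis
      using i by simp
  next
    case False
    then have "\<sigma> x = x" "\<tau> x = x"
      using \<sigma> \<tau> by (auto simp: permutes_not_in)
    moreover have "\<pi> x = x"
      using False by (auto simp: \<pi>_def)
    ultimately show ?thesis by simp
  qed
  have "{1..n} \<subseteq> \<pi> ` {1..n}"
  proof
    fix z assume z: "z \<in> {1..n}"
    have "orbit \<tau> z \<in> h ` orbit \<sigma> ` {1..n}"
      using h z by (auto simp: bij_betw_def)
    then obtain x where x: "x \<in> {1..n}" "orbit \<tau> z = h (orbit \<sigma> x)" by auto
    have "z \<in> orbit \<tau> (y (orbit \<sigma> x))"
      using x y[OF x(1)] permutation_self_in_orbit[OF perm(2), of z] by simp
    then obtain i where "z = (\<tau> ^^ i) (y (orbit \<sigma> x))"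
      by (auto simp: orbit_altdef_permutation[OF perm(2)])
    then have "z = \<pi> ((\<sigma> ^^ i) (b (orbit \<sigma> x)))"
      by (simp add: \<pi>_pow[OF x(1)])
    then show "z \<in> \<pi> ` {1..n}"
      using b[OF x(1)] pow_in by auto
  qed
  then have "bij_betw \<pi> {1..n} {1..n}"
    by (metis bij_betw_def card_image_le card_seteq eq_card_imp_inj_on finite_atLeastAtMost finite_imageI)
  then have "\<pi> permutes {1..n}"
    by (rule bij_imp_permutes) (auto simp: \<pi>_def)
  with comm show ?thesis by (auto simp: fun_eq_iff)
qed

lemma cycle_type_in_partitions:
  assumes \<sigma>: "\<sigma> permutes {1..n}"
  shows "cycle_type n \<sigma> \<in> partitions n"
proof -
  have perm: "permutation \<sigma>"
    using \<sigma> by (auto intro: permutation_permutes[THEN iffD2])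
  have self: "x \<in> orbit \<sigma> x" for x
    using permutation_self_in_orbit[OF perm] .
  have fin: "finite (orbit \<sigma> x)" for x
    by (rule finite_orbit[OF self])
  have "sum_mset (cycle_type n \<sigma>) = (\<Sum>X\<in>orbit \<sigma> ` {1..n}. card X)"
    by (simp add: cycle_type_def sum_unfold_sum_mset)
  also have "\<dots> = card (\<Union>(orbit \<sigma> ` {1..n}))"
  proof (rule card_Union_disjoint[symmetric])
    show "pairwise disjnt (orbit \<sigma> ` {1..n})"
      unfolding pairwise_def disjnt_def
      by (smt (verit) disjoint_iff image_iff orbit_cyclic_eq3 cyclic_on_orbit'[OF perm])
  qed (use fin in auto)
  also have "\<Union>(orbit \<sigma> ` {1..n}) = {1..n}"
    using self permutes_orbit_subset[OF \<sigma>] by blast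
  finally have "sum_mset (cycle_type n \<sigma>) = n" by simp
  moreover have "0 \<notin># cycle_type n \<sigma>"
    using fin orbit_nonempty[of \<sigma>] by (auto simp: cycle_type_def)
  ultimately show ?thesis by (simp add: partitions_def)
qed

lemma finite_partitions: "finite (partitions n)"
proof (rule finite_subset)
  show "partitions n \<subseteq> {\<mu>. set_mset \<mu> \<subseteq> {..n} \<and> size \<mu> \<le> n}"
  proof safe
    fix \<mu> x assume \<mu>: "\<mu> \<in> partitions n"
    then have s: "sum_mset \<mu> = n" and p: "0 \<notin># \<mu>" by (auto simp: partitions_def)
    show "x \<le> n" if "x \<in># \<mu>"
      using s multi_member_split[OF that] by auto
    have "size \<mu> \<le> sum_mset \<mu>"
      using p by (induction \<mu>) auto
    with s show "size \<mu> \<le> n" by simp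
  qed
  have "{\<mu>. set_mset \<mu> \<subseteq> {..n} \<and> size \<mu> \<le> n} \<subseteq> mset ` {xs. set xs \<subseteq> {..n} \<and> length xs \<le> n}"
  proof
    fix \<mu> assume "\<mu> \<in> {\<mu>. set_mset \<mu> \<subseteq> {..n} \<and> size \<mu> \<le> n}"
    moreover obtain xs where "mset xs = \<mu>" using ex_mset by blast
    ultimately show "\<mu> \<in> mset ` {xs. set xs \<subseteq> {..n} \<and> length xs \<le> n}" by force
  qed
  then show "finite {\<mu>. set_mset \<mu> \<subseteq> {..n} \<and> size \<mu> \<le> n}"
    by (rule finite_subset) (intro finite_imageI finite_lists_length_le finite_atMost)
qed

section \<open>Haar integrals of monomials in the matrix entries\<close>

lemma mat_adjoint_index:
  fixes A :: "complex mat"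
  assumes "i < dim_col A" "j < dim_row A"
  shows "mat_adjoint A $$ (i, j) = cnj (A $$ (j, i))"
  using assms by (simp add: mat_adjoint_def mat_of_rows_def)

lemma dim_mat_adjoint [simp]:
  fixes A :: "complex mat"
  shows "dim_row (mat_adjoint A) = dim_col A" "dim_col (mat_adjoint A) = dim_row A"
  by (simp_all add: mat_adjoint_def)

lemma mult_adjoint_eq_one_iff:
  fixes U :: "complex mat"
  assumes "U \<in> carrier_mat d d"
  shows "U * mat_adjoint U = 1\<^sub>m d \<longleftrightarrow>
    (\<forall>i<d. \<forall>j<d. (\<Sum>k<d. U $$ (i, k) * cnj (U $$ (j, k))) = of_bool (i = j))"
proof -
  have "(U * mat_adjoint U) $$ (i, j) = (\<Sum>k<d. U $$ (i, k) * cnj (U $$ (j, k)))"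
    if "i < d" "j < d" for i j
    using assms that by (simp add: scalar_prod_def mat_adjoint_index atLeast0LessThan)
  then show ?thesis
    using assms by (auto simp: mat_eq_iff)
qed

lemma adjoint_mult_eq_one_iff:
  fixes U :: "complex mat"
  assumes "U \<in> carrier_mat d d"
  shows "mat_adjoint U * U = 1\<^sub>m d \<longleftrightarrow>
    (\<forall>i<d. \<forall>j<d. (\<Sum>k<d. cnj (U $$ (k, i)) * U $$ (k, j)) = of_bool (i = j))"
proof -
  have "(mat_adjoint U * U) $$ (i, j) = (\<Sum>k<d. cnj (U $$ (k, i)) * U $$ (k, j))"
    if "i < d" "j < d" for i j
    using assms that by (simp add: scalar_prod_def mat_adjoint_index atLeast0LessThan)
  then show ?thesis
    using assms by (auto simp: mat_eq_iff)
qed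

lemma unitary_entry_norm_le_1:
  assumes U: "U \<in> unitary_group d" and ij: "i < d" "j < d"
  shows "norm (U $$ (i, j)) \<le> 1"
proof -
  have "(\<Sum>k<d. U $$ (i, k) * cnj (U $$ (i, k))) = 1"
    using U ij mult_adjoint_eq_one_iff[of U d] by (auto simp: unitary_group_def)
  then have "complex_of_real (\<Sum>k<d. (norm (U $$ (i, k)))\<^sup>2) = of_real 1"
    by (simp only: complex_norm_square[symmetric] of_real_sum of_real_1 flip: of_real_power)
  then have "(\<Sum>k<d. (norm (U $$ (i, k)))\<^sup>2) = 1"
    by (simp only: of_real_eq_iff)
  moreover have "(norm (U $$ (i, j)))\<^sup>2 \<le> (\<Sum>k<d. (norm (U $$ (i, k)))\<^sup>2)"
    by (rule member_le_sum) (use ij in auto)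
  ultimately have "(norm (U $$ (i, j)))\<^sup>2 \<le> 1\<^sup>2" by simp
  then show ?thesis
    by (rule power2_le_imp_le) simp
qed

lemma mult_in_unitary_group:
  assumes "V \<in> unitary_group d" "U \<in> unitary_group d"
  shows "V * U \<in> unitary_group d"
proof -
  have V: "V \<in> carrier_mat d d" "V * mat_adjoint V = 1\<^sub>m d" "mat_adjoint V * V = 1\<^sub>m d"
    and U: "U \<in> carrier_mat d d" "U * mat_adjoint U = 1\<^sub>m d" "mat_adjoint U * U = 1\<^sub>m d"
    using assms by (auto simp: unitary_group_def)
  have car: "mat_adjoint V \<in> carrier_mat d d" "mat_adjoint U \<in> carrier_mat d d"
    using V(1) U(1) by (auto intro!: carrier_matI)
  have adj: "mat_adjoint (V * U) = mat_adjoint U * mat_adjoint V"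
  proof (rule eq_matI)
    fix i j assume "i < dim_row (mat_adjoint U * mat_adjoint V)" "j < dim_col (mat_adjoint U * mat_adjoint V)"
    then show "mat_adjoint (V * U) $$ (i, j) = (mat_adjoint U * mat_adjoint V) $$ (i, j)"
      using V(1) U(1)
      by (simp add: mat_adjoint_index scalar_prod_def mult.commute)
  qed (use V(1) U(1) in simp_all)
  have "(V * U) * mat_adjoint (V * U) = V * (U * mat_adjoint U) * mat_adjoint V"
    using V(1) U(1) car by (simp add: adj assoc_mult_mat[of _ d d _ d _ d])
  moreover have "mat_adjoint (V * U) * (V * U) = mat_adjoint U * (mat_adjoint V * V) * U"
    using V(1) U(1) car by (simp add: adj assoc_mult_mat[of _ d d _ d _ d])
  ultimately show ?thesis
    using V U by (simp add: unitary_group_def)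
qed

lemma space_normalized_haar:
  assumes "normalized_haar d M" shows "space M = unitary_group d"
  using assms sets_eq_imp_space_eq[of M "unitary_borel d"]
  by (simp add: normalized_haar_def unitary_borel_def)

lemma borel_measurable_entry:
  assumes M: "normalized_haar d M" and ij: "i < d" "j < d"
  shows "(\<lambda>U. U $$ (i, j)) \<in> borel_measurable M"
proof -
  have "(\<lambda>U. \<lambda>ij\<in>{..<d} \<times> {..<d}. U $$ ij) \<in>
      measurable (unitary_borel d) (\<Pi>\<^sub>M ij\<in>{..<d} \<times> {..<d}. (borel :: complex measure))"
    unfolding unitary_borel_def by (rule measurable_vimage_algebra1) (auto simp: space_PiM)
  from measurable_compose[OF this measurable_component_singleton[of "(i, j)"]] ij
  have "(\<lambda>U. U $$ (i, j)) \<in> borel_measurable (unitary_borel d)" by simp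
  moreover have "sets M = sets (unitary_borel d)"
    using M by (simp add: normalized_haar_def)
  ultimately show ?thesis
    by (simp cong: measurable_cong_sets)
qed

text \<open>Without this, \<open>distr M M\<close> in the definition of Haar measure would carry no information about
  integrals: it is the change of variables that needs the translation to be measurable.\<close>

lemma measurable_left_translation:
  assumes M: "normalized_haar d M" and V: "V \<in> unitary_group d"
  shows "(\<lambda>U. V * U) \<in> measurable M M"
proof -
  have VC: "V \<in> carrier_mat d d" using V by (simp add: unitary_group_def)
  have UC: "U \<in> carrier_mat d d" if "U \<in> space M" for U
    using that by (simp add: space_normalized_haar[OF M] unitary_group_def)
  have "(\<lambda>U. \<lambda>ij\<in>{..<d} \<times> {..<d}. (V * U) $$ ij) \<in>
      measurable M (\<Pi>\<^sub>M ij\<in>{..<d} \<times> {..<d}. (borel :: complex measure))"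
  proof (rule measurable_restrict)
    fix ij :: "nat \<times> nat" assume "ij \<in> {..<d} \<times> {..<d}"
    then obtain i j where ij: "ij = (i, j)" "i < d" "j < d" by auto
    have "(\<lambda>U. \<Sum>k<d. V $$ (i, k) * U $$ (k, j)) \<in> borel_measurable M"
      using borel_measurable_entry[OF M] ij
      by (intro borel_measurable_sum borel_measurable_times borel_measurable_const) auto
    moreover have "(V * U) $$ (i, j) = (\<Sum>k<d. V $$ (i, k) * U $$ (k, j))" if "U \<in> space M" for U
      using VC UC[OF that] ij by (simp add: scalar_prod_def atLeast0LessThan)
    ultimately show "(\<lambda>U. (V * U) $$ ij) \<in> borel_measurable M"
      using ij(1) by (subst measurable_cong) auto
  qed
  then have "(\<lambda>U. V * U) \<in> measurable M (unitary_borel d)"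
    unfolding unitary_borel_def using mult_in_unitary_group[OF V] space_normalized_haar[OF M]
    by (intro measurable_vimage_algebra2) auto
  moreover have "sets M = sets (unitary_borel d)"
    using M by (simp add: normalized_haar_def)
  ultimately show ?thesis
    by (simp cong: measurable_cong_sets)
qed

lemma haar_integral_left_invariant:
  fixes f :: "complex mat \<Rightarrow> complex"
  assumes M: "normalized_haar d M" and V: "V \<in> unitary_group d" and f: "f \<in> borel_measurable M"
  shows "(LINT U|M. f (V * U)) = (LINT U|M. f U)"
proof -
  have "(LINT U|M. f U) = (LINT U|distr M M (\<lambda>U. V * U). f U)"
    using M V by (simp add: normalized_haar_def)
  also have "\<dots> = (LINT U|M. f (V * U))"
    by (rule integral_distr[OF measurable_left_translation[OF M V] f])
  finally show ?thesis ..
qed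

text \<open>The entries of a unitary matrix are bounded by 1, so all polynomials in the entries and their
  conjugates are of this kind, which is closed under products where integrability is not.\<close>

definition bounded_measurable :: "complex mat measure \<Rightarrow> (complex mat \<Rightarrow> complex) \<Rightarrow> bool" where
  "bounded_measurable M f \<longleftrightarrow> f \<in> borel_measurable M \<and> (\<exists>B. \<forall>U\<in>space M. norm (f U) \<le> B)"

lemma bounded_measurable_integrable:
  assumes "normalized_haar d M" and "bounded_measurable M f"
  shows "integrable M f"
proof -
  interpret prob_space M using assms(1) by (simp add: normalized_haar_def)
  from assms(2) obtain B where "\<forall>U\<in>space M. norm (f U) \<le> B" "f \<in> borel_measurable M"
    by (auto simp: bounded_measurable_def)
  then show ?thesis by (intro integrable_const_bound[of _ B]) auto
qed

lemma bounded_measurable_mult: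
  assumes "bounded_measurable M f" "bounded_measurable M g"
  shows "bounded_measurable M (\<lambda>U. f U * g U)"
proof -
  from assms obtain A B where "\<forall>U\<in>space M. norm (f U) \<le> A" "\<forall>U\<in>space M. norm (g U) \<le> B"
    by (auto simp: bounded_measurable_def)
  then have "\<forall>U\<in>space M. norm (f U * g U) \<le> A * B"
    by (simp add: norm_mult mult_mono')
  with assms show ?thesis by (auto simp: bounded_measurable_def)
qed

lemma bounded_measurable_add:
  assumes "bounded_measurable M f" "bounded_measurable M g"
  shows "bounded_measurable M (\<lambda>U. f U + g U)"
proof -
  from assms obtain A B where "\<forall>U\<in>space M. norm (f U) \<le> A" "\<forall>U\<in>space M. norm (g U) \<le> B"
    by (auto simp: bounded_measurable_def)
  then have "\<forall>U\<in>space M. norm (f U + g U) \<le> A + B"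
    by (auto intro: norm_triangle_mono)
  with assms show ?thesis by (auto simp: bounded_measurable_def)
qed

lemma bounded_measurable_const: "bounded_measurable M (\<lambda>U. c)"
  by (auto simp: bounded_measurable_def)

lemma bounded_measurable_cnj:
  assumes "bounded_measurable M f" shows "bounded_measurable M (\<lambda>U. cnj (f U))"
  using assms measurable_compose[OF _ borel_measurable_continuous_onI[OF continuous_on_cnj[OF continuous_on_id]]]
  by (auto simp: bounded_measurable_def)

lemma bounded_measurable_prod:
  "(\<And>i. i \<in> I \<Longrightarrow> bounded_measurable M (f i)) \<Longrightarrow> bounded_measurable M (\<lambda>U. \<Prod>i\<in>I. f i U)"
  by (induction I rule: infinite_finite_induct)
    (auto intro: bounded_measurable_mult bounded_measurable_const)

lemma bounded_measurable_entry:
  assumes "normalized_haar d M" "i < d" "j < d"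
  shows "bounded_measurable M (\<lambda>U. U $$ (i, j))"
  unfolding bounded_measurable_def space_normalized_haar[OF assms(1)]
  using borel_measurable_entry[OF assms] unitary_entry_norm_le_1[of _ d i j] assms(2,3) by blast

lemmas bounded_measurable_intros = bounded_measurable_entry bounded_measurable_prod
  bounded_measurable_cnj bounded_measurable_const bounded_measurable_add bounded_measurable_mult

section \<open>Unitary transformations of two rows\<close>

text \<open>Multiplication by this matrix from the left replaces the rows \<open>p\<close> and \<open>q\<close> by the combinations with
  coefficients \<open>(\<alpha>, \<beta>)\<close> and \<open>(\<gamma>, \<delta>)\<close> and keeps all other rows.\<close>

definition two_row_mat :: "nat \<Rightarrow> nat \<Rightarrow> nat \<Rightarrow> complex \<Rightarrow> complex \<Rightarrow> complex \<Rightarrow> complex \<Rightarrow> complex mat" where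
  "two_row_mat d p q \<alpha> \<beta> \<gamma> \<delta> = mat d d (\<lambda>(i, k).
     if i = p then (if k = p then \<alpha> else if k = q then \<beta> else 0)
     else if i = q then (if k = p then \<gamma> else if k = q then \<delta> else 0)
     else of_bool (k = i))"

lemma two_row_mat_index:
  assumes "i < d" "k < d"
  shows "two_row_mat d p q \<alpha> \<beta> \<gamma> \<delta> $$ (i, k) =
     (if i = p then (if k = p then \<alpha> else if k = q then \<beta> else 0)
     else if i = q then (if k = p then \<gamma> else if k = q then \<delta> else 0)
     else of_bool (k = i))"
  using assms by (simp add: two_row_mat_def)

lemma sum_two_points:
  fixes f :: "nat \<Rightarrow> 'a::comm_monoid_add"
  assumes "p < d" "q < d" "p \<noteq> q" "\<And>k. k < d \<Longrightarrow> k \<noteq> p \<Longrightarrow> k \<noteq> q \<Longrightarrow> f k = 0"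
  shows "(\<Sum>k<d. f k) = f p + f q"
proof -
  have "(\<Sum>k<d. f k) = (\<Sum>k\<in>{p, q}. f k)"
    by (rule sum.mono_neutral_right) (use assms in auto)
  with assms show ?thesis by simp
qed

lemma two_row_mat_mult_index:
  assumes U: "U \<in> carrier_mat d d" and pq: "p < d" "q < d" "p \<noteq> q" and j: "j < d"
  shows "(two_row_mat d p q \<alpha> \<beta> \<gamma> \<delta> * U) $$ (p, j) = \<alpha> * U $$ (p, j) + \<beta> * U $$ (q, j)"
    and "(two_row_mat d p q \<alpha> \<beta> \<gamma> \<delta> * U) $$ (q, j) = \<gamma> * U $$ (p, j) + \<delta> * U $$ (q, j)"
    and "i < d \<Longrightarrow> i \<noteq> p \<Longrightarrow> i \<noteq> q \<Longrightarrow> (two_row_mat d p q \<alpha> \<beta> \<gamma> \<delta> * U) $$ (i, j) = U $$ (i, j)"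
proof -
  have *: "(two_row_mat d p q \<alpha> \<beta> \<gamma> \<delta> * U) $$ (i, j) =
      (\<Sum>k<d. two_row_mat d p q \<alpha> \<beta> \<gamma> \<delta> $$ (i, k) * U $$ (k, j))" if "i < d" for i
    using U j that by (simp add: two_row_mat_def scalar_prod_def atLeast0LessThan)
  show "(two_row_mat d p q \<alpha> \<beta> \<gamma> \<delta> * U) $$ (p, j) = \<alpha> * U $$ (p, j) + \<beta> * U $$ (q, j)"
    using pq by (subst *, simp, subst sum_two_points[of p d q]) (auto simp: two_row_mat_index)
  show "(two_row_mat d p q \<alpha> \<beta> \<gamma> \<delta> * U) $$ (q, j) = \<gamma> * U $$ (p, j) + \<delta> * U $$ (q, j)"
    using pq by (subst *, simp, subst sum_two_points[of p d q]) (auto simp: two_row_mat_index)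
  show "(two_row_mat d p q \<alpha> \<beta> \<gamma> \<delta> * U) $$ (i, j) = U $$ (i, j)"
    if "i < d" "i \<noteq> p" "i \<noteq> q"
    using that by (simp add: * two_row_mat_index of_bool_def if_distrib[of "\<lambda>t. t * _"] sum.delta' cong: if_cong)
qed

lemma two_row_mat_unitary:
  assumes pq: "p < d" "q < d" "p \<noteq> q"
    and row: "\<alpha> * cnj \<alpha> + \<beta> * cnj \<beta> = 1" "\<gamma> * cnj \<gamma> + \<delta> * cnj \<delta> = 1" "\<alpha> * cnj \<gamma> + \<beta> * cnj \<delta> = 0"
    and col: "\<alpha> * cnj \<alpha> + \<gamma> * cnj \<gamma> = 1" "\<beta> * cnj \<beta> + \<delta> * cnj \<delta> = 1" "\<alpha> * cnj \<beta> + \<gamma> * cnj \<delta> = 0"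
  shows "two_row_mat d p q \<alpha> \<beta> \<gamma> \<delta> \<in> unitary_group d"
proof -
  let ?V = "two_row_mat d p q \<alpha> \<beta> \<gamma> \<delta>"
  have V: "?V \<in> carrier_mat d d" by (simp add: two_row_mat_def)
  have row': "\<gamma> * cnj \<alpha> + \<delta> * cnj \<beta> = 0"
    using arg_cong[OF row(3), of cnj] by (simp add: mult.commute)
  have col': "cnj \<beta> * \<alpha> + cnj \<delta> * \<gamma> = 0" "cnj \<alpha> * \<beta> + cnj \<gamma> * \<delta> = 0"
      "cnj \<alpha> * \<alpha> + cnj \<gamma> * \<gamma> = 1" "cnj \<beta> * \<beta> + cnj \<delta> * \<delta> = 1"
    subgoal using col(3) by (simp add: mult.commute)
    subgoal using arg_cong[OF col(3), of cnj] by simp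
    using col by (simp_all add: mult.commute)
  have "(\<Sum>k<d. ?V $$ (i, k) * cnj (?V $$ (j, k))) = of_bool (i = j)" if ij: "i < d" "j < d" for i j
  proof (cases "i \<in> {p, q} \<or> j \<in> {p, q}")
    case True
    then have "(\<Sum>k<d. ?V $$ (i, k) * cnj (?V $$ (j, k))) =
        ?V $$ (i, p) * cnj (?V $$ (j, p)) + ?V $$ (i, q) * cnj (?V $$ (j, q))"
      using ij pq by (intro sum_two_points) (auto simp: two_row_mat_index)
    also have "\<dots> = of_bool (i = j)"
      using True ij pq by (auto simp: two_row_mat_index row row')
    finally show ?thesis .
  next
    case False
    then have "(\<Sum>k<d. ?V $$ (i, k) * cnj (?V $$ (j, k))) = (\<Sum>k<d. if k = i then of_bool (i = j) else 0)"
      using ij by (intro sum.cong) (auto simp: two_row_mat_index)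
    then show ?thesis using ij by simp
  qed
  moreover have "(\<Sum>k<d. cnj (?V $$ (k, i)) * ?V $$ (k, j)) = of_bool (i = j)" if ij: "i < d" "j < d" for i j
  proof (cases "i \<in> {p, q} \<or> j \<in> {p, q}")
    case True
    then have "(\<Sum>k<d. cnj (?V $$ (k, i)) * ?V $$ (k, j)) =
        cnj (?V $$ (p, i)) * ?V $$ (p, j) + cnj (?V $$ (q, i)) * ?V $$ (q, j)"
      using ij pq by (intro sum_two_points) (auto simp: two_row_mat_index)
    also have "\<dots> = of_bool (i = j)"
      using True ij pq by (auto simp: two_row_mat_index col')
    finally show ?thesis .
  next
    case False
    then have "(\<Sum>k<d. cnj (?V $$ (k, i)) * ?V $$ (k, j)) = (\<Sum>k<d. if k = i then of_bool (i = j) else 0)"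
      using ij by (intro sum.cong) (auto simp: two_row_mat_index)
    then show ?thesis using ij by simp
  qed
  ultimately show ?thesis
    using V by (simp add: unitary_group_def mult_adjoint_eq_one_iff adjoint_mult_eq_one_iff)
qed

definition ignores_rows :: "nat \<Rightarrow> nat set \<Rightarrow> (complex mat \<Rightarrow> complex) \<Rightarrow> bool" where
  "ignores_rows d R g \<longleftrightarrow> (\<forall>U V. U \<in> carrier_mat d d \<longrightarrow> V \<in> carrier_mat d d \<longrightarrow>
     (\<forall>i j. i < d \<longrightarrow> j < d \<longrightarrow> i \<notin> R \<longrightarrow> U $$ (i, j) = V $$ (i, j)) \<longrightarrow> g U = g V)"

lemma ignores_rows_two_row_mat:
  assumes g: "ignores_rows d {p, q} g" and pq: "p < d" "q < d" "p \<noteq> q" and U: "U \<in> carrier_mat d d"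
  shows "g (two_row_mat d p q \<alpha> \<beta> \<gamma> \<delta> * U) = g U"
proof -
  have "two_row_mat d p q \<alpha> \<beta> \<gamma> \<delta> * U \<in> carrier_mat d d"
    using U by (auto simp: two_row_mat_def)
  then show ?thesis
    using g U two_row_mat_mult_index(3)[OF U pq, of _ _ \<alpha> \<beta> \<gamma> \<delta>]
    unfolding ignores_rows_def by blast
qed

text \<open>Left invariance for an integrand in which the rows \<open>p\<close> and \<open>q\<close> enter through \<open>F\<close>, while the factor \<open>g\<close>
  only sees the other rows and is therefore not changed by the transformation. Since \<open>F\<close> receives rows as
  functions on all indices, \<open>cong\<close> makes sure that it only looks at the indices below \<open>d\<close>.\<close>

lemma haar_integral_two_rows:
  fixes F :: "(nat \<Rightarrow> complex) \<Rightarrow> (nat \<Rightarrow> complex) \<Rightarrow> complex"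
  assumes M: "normalized_haar d M" and pq: "p < d" "q < d" "p \<noteq> q"
    and uni: "two_row_mat d p q \<alpha> \<beta> \<gamma> \<delta> \<in> unitary_group d"
    and g: "ignores_rows d {p, q} g"
    and meas: "(\<lambda>U. F (\<lambda>j. U $$ (p, j)) (\<lambda>j. U $$ (q, j)) * g U) \<in> borel_measurable M"
    and cong: "\<And>r r' s s'. (\<And>j. j < d \<Longrightarrow> r j = r' j) \<Longrightarrow> (\<And>j. j < d \<Longrightarrow> s j = s' j) \<Longrightarrow> F r s = F r' s'"
  shows "(LINT U|M. F (\<lambda>j. \<alpha> * U $$ (p, j) + \<beta> * U $$ (q, j)) (\<lambda>j. \<gamma> * U $$ (p, j) + \<delta> * U $$ (q, j)) * g U)
    = (LINT U|M. F (\<lambda>j. U $$ (p, j)) (\<lambda>j. U $$ (q, j)) * g U)" (is "?L = ?R")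
proof -
  let ?V = "two_row_mat d p q \<alpha> \<beta> \<gamma> \<delta>"
  have "?L = (LINT U|M. F (\<lambda>j. (?V * U) $$ (p, j)) (\<lambda>j. (?V * U) $$ (q, j)) * g (?V * U))"
  proof (rule Bochner_Integration.integral_cong[OF refl])
    fix U assume "U \<in> space M"
    then have U: "U \<in> carrier_mat d d"
      by (simp add: space_normalized_haar[OF M] unitary_group_def)
    show "F (\<lambda>j. \<alpha> * U $$ (p, j) + \<beta> * U $$ (q, j)) (\<lambda>j. \<gamma> * U $$ (p, j) + \<delta> * U $$ (q, j)) * g U =
        F (\<lambda>j. (?V * U) $$ (p, j)) (\<lambda>j. (?V * U) $$ (q, j)) * g (?V * U)"
      unfolding ignores_rows_two_row_mat[OF g pq U]
      by (intro arg_cong2[of _ _ _ _ "(*)"] cong refl)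
         (simp_all only: two_row_mat_mult_index(1,2)[OF U pq])
  qed
  also have "\<dots> = ?R"
    by (rule haar_integral_left_invariant[OF M uni meas])
  finally show ?thesis .
qed

text \<open>Averaging over the fourth roots of unity removes every monomial in which $\omega$ and $\overline\omega$ do not
  occur equally often: the difference of the two exponents lies between -2 and 2.\<close>

lemma fourth_root_of_unity_average:
  fixes p1 p2 p3 p4 q1 q2 q3 q4 :: complex
  shows "(\<Sum>\<omega>\<leftarrow>[1, -1, \<i>, -\<i>]. (p1 + \<omega> * q1) * (p2 + \<omega> * q2) * cnj ((p3 + \<omega> * q3) * (p4 + \<omega> * q4))) =
    4 * (p1 * p2 * cnj (p3 * p4) + q1 * q2 * cnj (q3 * q4)
      + (p1 * q2 + q1 * p2) * cnj (p3 * q4 + q3 * p4))"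
  by (simp add: algebra_simps)

text \<open>Let $X_{abce}$ be the integral of $u_{aj_1} u_{bj_2} \overline u_{cj_3} \overline u_{ej_4}\,g$. Mixing the two rows
  by the unitary matrix with first row $(1,\omega)/\sqrt 2$ expresses $X_{pppp}$ through all sixteen $X_{abce}$, and
  the average over the fourth roots of unity $\omega$ keeps the balanced ones:
  $4 X_{pppp} = X_{pppp} + X_{qqqq} + X_{pqpq} + X_{qpqp} + X_{pqqp} + X_{qppq}$. Swapping the rows identifies these
  six in pairs, which leaves $X_{pppp} = X_{pqpq} + X_{pqqp}$.\<close>

lemma haar_integral_row_exchange:
  assumes M: "normalized_haar d M" and pq: "p < d" "q < d" "p \<noteq> q"
    and j: "j1 < d" "j2 < d" "j3 < d" "j4 < d"
    and g: "ignores_rows d {p, q} g" "bounded_measurable M g"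
  shows "(LINT U|M. U $$ (p, j1) * U $$ (p, j2) * cnj (U $$ (p, j3) * U $$ (p, j4)) * g U) =
    (LINT U|M. U $$ (p, j1) * U $$ (q, j2) * cnj (U $$ (p, j3) * U $$ (q, j4)) * g U) +
    (LINT U|M. U $$ (p, j1) * U $$ (q, j2) * cnj (U $$ (q, j3) * U $$ (p, j4)) * g U)"
proof -
  define X where "X a b c e = (LINT U|M. U $$ (a, j1) * U $$ (b, j2) * cnj (U $$ (c, j3) * U $$ (e, j4)) * g U)" for a b c e
  have int: "integrable M (\<lambda>U. U $$ (a, j1) * U $$ (b, j2) * cnj (U $$ (c, j3) * U $$ (e, j4)) * g U)"
    if "a < d" "b < d" "c < d" "e < d" for a b c e
    using that j g by (intro bounded_measurable_integrable[OF M] bounded_measurable_intros) (use M in auto)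
  have meas: "(\<lambda>U. U $$ (a, j1) * U $$ (b, j2) * cnj (U $$ (c, j3) * U $$ (e, j4)) * g U) \<in> borel_measurable M"
    if "a < d" "b < d" "c < d" "e < d" for a b c e
    using int[OF that] by (rule borel_measurable_integrable)
  have swap: "two_row_mat d p q 0 1 1 0 \<in> unitary_group d"
    by (rule two_row_mat_unitary[OF pq]) auto
  have X_q: "X q q q q = X p p p p"
    unfolding X_def
    using haar_integral_two_rows[OF M pq swap g(1), of "\<lambda>r s. r j1 * r j2 * cnj (r j3 * r j4)"] meas pq j
    by simp
  have X_qpqp: "X q p q p = X p q p q"
    unfolding X_def
    using haar_integral_two_rows[OF M pq swap g(1), of "\<lambda>r s. r j1 * s j2 * cnj (r j3 * s j4)"] meas pq j
    by simp
  have X_qppq: "X q p p q = X p q q p"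
    unfolding X_def
    using haar_integral_two_rows[OF M pq swap g(1), of "\<lambda>r s. r j1 * s j2 * cnj (s j3 * r j4)"] meas pq j
    by simp
  define f where "f \<omega> U = (U $$ (p, j1) + \<omega> * U $$ (q, j1)) * (U $$ (p, j2) + \<omega> * U $$ (q, j2)) *
      cnj ((U $$ (p, j3) + \<omega> * U $$ (q, j3)) * (U $$ (p, j4) + \<omega> * U $$ (q, j4))) * g U" for \<omega> U
  have int_f: "integrable M (f \<omega>)" for \<omega>
    unfolding f_def using pq j g
    by (intro bounded_measurable_integrable[OF M] bounded_measurable_intros) (use M in auto)
  have f: "(LINT U|M. f \<omega> U) = 4 * X p p p p" if \<omega>: "\<omega> * cnj \<omega> = 1" for \<omega>
  proof -
    define c where "c = complex_of_real (1 / sqrt 2)"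
    \<comment> \<open>Each of the four linear factors contributes one $1/\sqrt 2$, hence the $1/4$.\<close>
    have c: "c * c = 1/2" "cnj c = c"
      by (simp_all add: c_def flip: of_real_mult)
    have c4: "c * (c * (c * c)) = 1/4"
      by (simp add: c(1))
    have \<omega>': "c * \<omega> * (c * cnj \<omega>) = 1/2"
      using \<omega> c(1) by (metis mult.assoc mult.commute mult.right_neutral)
    have "two_row_mat d p q c (c * \<omega>) c (- (c * \<omega>)) \<in> unitary_group d"
      by (rule two_row_mat_unitary[OF pq]) (auto simp: c \<omega>')
    from haar_integral_two_rows[OF M pq this g(1), of "\<lambda>r s. r j1 * r j2 * cnj (r j3 * r j4)"] meas pq j
    have "X p p p p = (LINT U|M. (c * U $$ (p, j1) + c * \<omega> * U $$ (q, j1)) * (c * U $$ (p, j2) + c * \<omega> * U $$ (q, j2)) *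
      cnj ((c * U $$ (p, j3) + c * \<omega> * U $$ (q, j3)) * (c * U $$ (p, j4) + c * \<omega> * U $$ (q, j4))) * g U)"
      by (simp add: X_def)
    also have "\<dots> = (LINT U|M. (1/4) * f \<omega> U)"
    proof (rule Bochner_Integration.integral_cong[OF refl])
      fix U
      have "(c * x1 + c * \<omega> * y1) * (c * x2 + c * \<omega> * y2) * cnj ((c * x3 + c * \<omega> * y3) * (c * x4 + c * \<omega> * y4)) * z
        = (c * (c * (c * c))) * ((x1 + \<omega> * y1) * (x2 + \<omega> * y2) * cnj ((x3 + \<omega> * y3) * (x4 + \<omega> * y4)) * z)"
        for x1 x2 x3 x4 y1 y2 y3 y4 z
      proof -
        have e: "c * x + c * w * y = c * (x + w * y)" for x w y
          by (simp add: algebra_simps)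
        show ?thesis
          unfolding complex_cnj_mult complex_cnj_add c(2) e by (simp only: mult_ac)
      qed
      then show "(c * U $$ (p, j1) + c * \<omega> * U $$ (q, j1)) * (c * U $$ (p, j2) + c * \<omega> * U $$ (q, j2)) *
        cnj ((c * U $$ (p, j3) + c * \<omega> * U $$ (q, j3)) * (c * U $$ (p, j4) + c * \<omega> * U $$ (q, j4))) * g U
        = (1/4) * f \<omega> U"
        unfolding c4 f_def .
    qed
    finally show ?thesis by (simp add: mult.commute)
  qed
  have "4 * X p p p p + 4 * X p p p p + 4 * X p p p p + 4 * X p p p p =
      (LINT U|M. f 1 U + f (-1) U + f \<i> U + f (-\<i>) U)"
    using int_f by (simp add: f)
  also have "\<dots> = (LINT U|M. 4 * (U $$ (p, j1) * U $$ (p, j2) * cnj (U $$ (p, j3) * U $$ (p, j4)) * g U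
      + U $$ (q, j1) * U $$ (q, j2) * cnj (U $$ (q, j3) * U $$ (q, j4)) * g U
      + U $$ (p, j1) * U $$ (q, j2) * cnj (U $$ (p, j3) * U $$ (q, j4)) * g U
      + U $$ (p, j1) * U $$ (q, j2) * cnj (U $$ (q, j3) * U $$ (p, j4)) * g U
      + U $$ (q, j1) * U $$ (p, j2) * cnj (U $$ (p, j3) * U $$ (q, j4)) * g U
      + U $$ (q, j1) * U $$ (p, j2) * cnj (U $$ (q, j3) * U $$ (p, j4)) * g U))"
  proof (rule Bochner_Integration.integral_cong[OF refl])
    fix U :: "complex mat"
    let ?P = "\<lambda>j. U $$ (p, j)" and ?Q = "\<lambda>j. U $$ (q, j)"
    have "f 1 U + f (-1) U + f \<i> U + f (-\<i>) U =
      (\<Sum>\<omega>\<leftarrow>[1, -1, \<i>, -\<i>]. (?P j1 + \<omega> * ?Q j1) * (?P j2 + \<omega> * ?Q j2)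
        * cnj ((?P j3 + \<omega> * ?Q j3) * (?P j4 + \<omega> * ?Q j4))) * g U"
      by (simp only: f_def list.map sum_list_simps distrib_right add_0_right add.assoc)
    also have "\<dots> = 4 * (?P j1 * ?P j2 * cnj (?P j3 * ?P j4) * g U
      + ?Q j1 * ?Q j2 * cnj (?Q j3 * ?Q j4) * g U + ?P j1 * ?Q j2 * cnj (?P j3 * ?Q j4) * g U
      + ?P j1 * ?Q j2 * cnj (?Q j3 * ?P j4) * g U + ?Q j1 * ?P j2 * cnj (?P j3 * ?Q j4) * g U
      + ?Q j1 * ?P j2 * cnj (?Q j3 * ?P j4) * g U)"
      unfolding fourth_root_of_unity_average complex_cnj_add by (simp only: algebra_simps)
    finally show "f 1 U + f (-1) U + f \<i> U + f (-\<i>) U = \<dots>" .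
  qed
  also have "\<dots> = 4 * (X p p p p + X q q q q + X p q p q + X p q q p + X q p p q + X q p q p)"
    using int pq by (simp add: X_def)
  finally have "4 * X p p p p + 4 * X p p p p + 4 * X p p p p + 4 * X p p p p = \<dots>" .
  then have "X p p p p = X p q p q + X p q q p"
    unfolding X_q X_qpqp X_qppq complex_eq_iff by simp
  then show ?thesis
    by (simp only: X_def)
qed

section \<open>The recurrence for the Weingarten function\<close>

lemma ignores_rows_prod_entries:
  assumes "\<And>i. i \<in> I \<Longrightarrow> r i < d" "\<And>i. i \<in> I \<Longrightarrow> c i < d" "\<And>i. i \<in> I \<Longrightarrow> c' i < d" "\<And>i. i \<in> I \<Longrightarrow> r i \<notin> R"
  shows "ignores_rows d R (\<lambda>U. (\<Prod>i\<in>I. U $$ (r i, c i)) * (\<Prod>i\<in>I. cnj (U $$ (r i, c' i))))"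
  unfolding ignores_rows_def using assms by (auto intro!: arg_cong2[of _ _ _ _ "(*)"] prod.cong)

text \<open>Row \<open>k\<close> takes the place of row \<open>n - 1\<close> in the last factor and its conjugate: \<open>S k\<close> is the resulting
  integral. The orthonormality of the columns evaluates \<open>(\<Sum>k<d. S k)\<close>. On the other hand \<open>S k\<close> is
  the Weingarten function itself for \<open>k \<ge> n - 1\<close> (\<open>last\<close>, \<open>beyond\<close>), and row exchange computes the
  terms with a repeated row (\<open>inner\<close>).\<close>

lemma weingarten_recurrence:
  assumes M: "normalized_haar d M" and n: "1 \<le> n" "n \<le> d" and \<sigma>: "\<sigma> permutes {1..n}"
  shows "of_nat d * weingarten n M \<sigma> + (\<Sum>k\<in>{1..<n}. weingarten n M (\<sigma> \<circ> Transposition.transpose k n)) = weingarten (n - 1) M \<sigma>"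
proof -
  define T where "T = (\<Sum>k\<in>{1..<n}. weingarten n M (\<sigma> \<circ> Transposition.transpose k n))"
  define g where "g I U = (\<Prod>i\<in>I. U $$ (i - 1, i - 1)) * (\<Prod>i\<in>I. cnj (U $$ (i - 1, \<sigma> i - 1)))"
    for I and U :: "complex mat"
  define S where "S k = (LINT U|M. U $$ (k, n - 1) * cnj (U $$ (k, \<sigma> n - 1)) * g {1..<n} U)" for k
  have \<sigma>_in: "\<sigma> i \<in> {1..n}" if "i \<in> {1..n}" for i
    using permutes_in_image[OF \<sigma>] that by blast
  have \<sigma>_less: "\<sigma> i - 1 < d" if "1 \<le> i" "i \<le> n" for i
    using \<sigma>_in[of i] that n by auto
  have bounded_g: "bounded_measurable M (g I)" if "I \<subseteq> {1..n}" for I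
    unfolding g_def using that n \<sigma>_less
    by (intro bounded_measurable_mult bounded_measurable_prod bounded_measurable_cnj bounded_measurable_entry[OF M])
      (auto dest!: subsetD)
  have meas: "bounded_measurable M (\<lambda>U. U $$ (k, n - 1) * cnj (U $$ (k, \<sigma> n - 1)) * g {1..<n} U)" if "k < d" for k
    using that n \<sigma>_less[of n]
    by (intro bounded_measurable_mult bounded_measurable_cnj bounded_measurable_entry[OF M] bounded_g) auto
  have insert_n: "{1..n} = insert n {1..<n}"
    using n by auto
  have W: "weingarten n M \<tau> = (LINT U|M. U $$ (n - 1, n - 1) * (\<Prod>i\<in>{1..<n}. U $$ (i - 1, i - 1)) *
      (cnj (U $$ (n - 1, \<tau> n - 1)) * (\<Prod>i\<in>{1..<n}. cnj (U $$ (i - 1, \<tau> i - 1)))))"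
    if "\<tau> permutes {1..n}" for \<tau>
    using that unfolding weingarten_def insert_n by simp
  have last: "S (n - 1) = weingarten n M \<sigma>"
    unfolding W[OF \<sigma>] S_def g_def by (simp add: mult_ac)
  have beyond: "S k = weingarten n M \<sigma>" if k: "n \<le> k" "k < d" for k
  proof -
    have "two_row_mat d (n - 1) k 0 1 1 0 \<in> unitary_group d"
      using k n by (intro two_row_mat_unitary) auto
    moreover have "ignores_rows d {n - 1, k} (g {1..<n})"
      unfolding g_def using k n \<sigma>_less by (intro ignores_rows_prod_entries) auto
    ultimately have "S k = S (n - 1)"
      using haar_integral_two_rows[OF M, of "n - 1" k 0 1 1 0 "g {1..<n}" "\<lambda>r s. r (n - 1) * cnj (r (\<sigma> n - 1))"]
        meas[of "n - 1"] k n \<sigma>_less[of n] by (simp add: S_def bounded_measurable_def)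
    with last show ?thesis by simp
  qed
  have inner: "S (k - 1) = weingarten n M \<sigma> + weingarten n M (\<sigma> \<circ> Transposition.transpose k n)" if k: "k \<in> {1..<n}" for k
  proof -
    let ?I = "{1..<n} - {k}"
    let ?\<tau> = "\<sigma> \<circ> Transposition.transpose k n"
    have split: "(\<Prod>i\<in>{1..<n}. h i) = h k * (\<Prod>i\<in>?I. h i)" for h :: "nat \<Rightarrow> complex"
      using k by (intro prod.remove) auto
    have \<tau>: "?\<tau> permutes {1..n}"
      using k by (intro permutes_compose[OF permutes_swap_id \<sigma>]) auto
    have \<tau>_eq: "(\<Prod>i\<in>?I. cnj (U $$ (i - 1, ?\<tau> i - 1))) = (\<Prod>i\<in>?I. cnj (U $$ (i - 1, \<sigma> i - 1)))" for U
      by (intro prod.cong) (auto simp: Transposition.transpose_def)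
    have "S (k - 1) = (LINT U|M. U $$ (k - 1, k - 1) * U $$ (k - 1, n - 1) *
        cnj (U $$ (k - 1, \<sigma> k - 1) * U $$ (k - 1, \<sigma> n - 1)) * g ?I U)"
      unfolding S_def g_def split by (simp add: mult_ac)
    also have "\<dots> = (LINT U|M. U $$ (k - 1, k - 1) * U $$ (n - 1, n - 1) *
        cnj (U $$ (k - 1, \<sigma> k - 1) * U $$ (n - 1, \<sigma> n - 1)) * g ?I U) +
      (LINT U|M. U $$ (k - 1, k - 1) * U $$ (n - 1, n - 1) *
        cnj (U $$ (n - 1, \<sigma> k - 1) * U $$ (k - 1, \<sigma> n - 1)) * g ?I U)"
    proof (rule haar_integral_row_exchange[OF M])
      show "ignores_rows d {k - 1, n - 1} (g ?I)"
        unfolding g_def using k n \<sigma>_less by (intro ignores_rows_prod_entries) auto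
      show "bounded_measurable M (g ?I)"
        by (rule bounded_g) (use k in auto)
    qed (use k n \<sigma>_less in auto)
    also have "(LINT U|M. U $$ (k - 1, k - 1) * U $$ (n - 1, n - 1) *
        cnj (U $$ (k - 1, \<sigma> k - 1) * U $$ (n - 1, \<sigma> n - 1)) * g ?I U) = weingarten n M \<sigma>"
      unfolding W[OF \<sigma>] g_def split by (simp add: mult_ac)
    also have "(LINT U|M. U $$ (k - 1, k - 1) * U $$ (n - 1, n - 1) *
        cnj (U $$ (n - 1, \<sigma> k - 1) * U $$ (k - 1, \<sigma> n - 1)) * g ?I U) = weingarten n M ?\<tau>"
      unfolding W[OF \<tau>] g_def split \<tau>_eq by (simp add: mult_ac)
    finally show ?thesis .
  qed
  have "(\<Sum>k<d. S k) = (\<Sum>k<n - 1. S k) + (S (n - 1) + (\<Sum>k\<in>{n..<d}. S k))"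
  proof -
    have "(\<Sum>k<d. S k) = (\<Sum>k\<in>{..<n - 1} \<union> insert (n - 1) {n..<d}. S k)"
      using n by (intro sum.cong) auto
    also have "\<dots> = (\<Sum>k<n - 1. S k) + (\<Sum>k\<in>insert (n - 1) {n..<d}. S k)"
      using n by (intro sum.union_disjoint) auto
    also have "(\<Sum>k\<in>insert (n - 1) {n..<d}. S k) = S (n - 1) + (\<Sum>k\<in>{n..<d}. S k)"
      using n by (intro sum.insert) auto
    finally show ?thesis .
  qed
  also have "(\<Sum>k<n - 1. S k) = (\<Sum>k\<in>{1..<n}. S (k - 1))"
    by (rule sum.reindex_bij_witness[of _ "\<lambda>k. k - 1" Suc]) auto
  also have "(\<Sum>k\<in>{1..<n}. S (k - 1)) = of_nat (n - 1) * weingarten n M \<sigma> + T"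
    unfolding T_def by (simp only: inner sum.distrib cong: sum.cong) simp
  also have "(\<Sum>k\<in>{n..<d}. S k) = of_nat (d - n) * weingarten n M \<sigma>"
    by (simp add: beyond)
  finally have "(\<Sum>k<d. S k) = of_nat d * weingarten n M \<sigma> + T"
    using n unfolding last by (simp add: of_nat_diff algebra_simps)
  moreover have "(\<Sum>k<d. S k) = weingarten (n - 1) M \<sigma>"
  proof -
    have "(\<Sum>k<d. S k) = (LINT U|M. (\<Sum>k<d. U $$ (k, n - 1) * cnj (U $$ (k, \<sigma> n - 1)) * g {1..<n} U))"
      unfolding S_def
      by (rule Bochner_Integration.integral_sum[symmetric])
        (use meas bounded_measurable_integrable[OF M] in auto)
    also have "\<dots> = (LINT U|M. of_bool (\<sigma> n = n) * g {1..<n} U)"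
    proof (rule Bochner_Integration.integral_cong[OF refl])
      fix U assume "U \<in> space M"
      then have U: "U \<in> carrier_mat d d" "mat_adjoint U * U = 1\<^sub>m d"
        by (auto simp: space_normalized_haar[OF M] unitary_group_def)
      have "(\<Sum>k<d. U $$ (k, n - 1) * cnj (U $$ (k, \<sigma> n - 1))) =
          (\<Sum>k<d. cnj (U $$ (k, \<sigma> n - 1)) * U $$ (k, n - 1))"
        by (simp only: mult.commute)
      also have "\<dots> = of_bool (\<sigma> n - 1 = n - 1)"
        using U adjoint_mult_eq_one_iff[OF U(1)] n \<sigma>_less[of n] by auto
      also have "\<sigma> n - 1 = n - 1 \<longleftrightarrow> \<sigma> n = n"
        using \<sigma>_in[of n] n by auto
      finally show "(\<Sum>k<d. U $$ (k, n - 1) * cnj (U $$ (k, \<sigma> n - 1)) * g {1..<n} U) =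
          of_bool (\<sigma> n = n) * g {1..<n} U"
        by (simp flip: sum_distrib_right)
    qed
    also have "\<dots> = weingarten (n - 1) M \<sigma>"
    proof (cases "\<sigma> n = n")
      case True
      have "\<sigma> permutes {1..n - 1}"
      proof (rule permutes_superset[OF \<sigma>])
        fix i assume "i \<in> {1..n} - {1..n - 1}"
        then have "i = n" by auto
        with True show "\<sigma> i = i" by simp
      qed
      moreover have "{1..n - 1} = {1..<n}"
        using n by auto
      ultimately show ?thesis
        using True by (simp add: weingarten_def g_def)
    next
      case False
      then have "\<not> \<sigma> permutes {1..n - 1}"
        using n by (auto dest: permutes_not_in[of _ _ n])
      with False show ?thesis by (simp add: weingarten_def)
    qed
    finally show ?thesis .
  qed
  ultimately show ?thesis by (simp only: T_def)
qed

section \<open>Convolution in the group algebra\<close>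

lemma group_algebra_mult_right:
  assumes "group G" and fin: "finite (carrier G)" and x: "x \<in> carrier G"
  shows "(f \<otimes>\<^bsub>group_algebra G\<^esub> g) x = (\<Sum>z\<in>carrier G. f (x \<otimes>\<^bsub>G\<^esub> inv\<^bsub>G\<^esub> z) * g z)"
proof -
  interpret G: group G by fact
  have "(f \<otimes>\<^bsub>group_algebra G\<^esub> g) x =
      (\<Sum>z\<in>carrier G. \<Sum>y\<in>carrier G. f y * g z * of_bool (y \<otimes>\<^bsub>G\<^esub> z = x))"
    unfolding group_algebra_mult_alt[OF fin] by (rule sum.swap)
  also have "\<dots> = (\<Sum>z\<in>carrier G. \<Sum>y\<in>carrier G. if y = x \<otimes>\<^bsub>G\<^esub> inv\<^bsub>G\<^esub> z then f y * g z else 0)"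
    using x by (intro sum.cong refl) (auto simp: G.inv_solve_right)
  finally show ?thesis
    using fin x by simp
qed

lemma group_algebra_mult_left:
  assumes "group G" and fin: "finite (carrier G)" and x: "x \<in> carrier G"
  shows "(f \<otimes>\<^bsub>group_algebra G\<^esub> g) x = (\<Sum>y\<in>carrier G. f y * g (inv\<^bsub>G\<^esub> y \<otimes>\<^bsub>G\<^esub> x))"
proof -
  interpret G: group G by fact
  have "(f \<otimes>\<^bsub>group_algebra G\<^esub> g) x =
      (\<Sum>y\<in>carrier G. \<Sum>z\<in>carrier G. f y * g z * of_bool (y \<otimes>\<^bsub>G\<^esub> z = x))"
    by (rule group_algebra_mult_alt[OF fin])
  also have "\<dots> = (\<Sum>y\<in>carrier G. \<Sum>z\<in>carrier G. if z = inv\<^bsub>G\<^esub> y \<otimes>\<^bsub>G\<^esub> x then f y * g z else 0)"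
    using x by (intro sum.cong refl) (auto simp: G.inv_solve_left)
  finally show ?thesis
    using fin x by simp
qed

lemma group_algebra_carrier: "f \<in> carrier (group_algebra G) \<longleftrightarrow> (\<forall>x. x \<notin> carrier G \<longrightarrow> f x = 0)"
  by (simp add: group_algebra_def)

text \<open>Commuting with the basis element \<open>z\<close> and comparing coefficients at \<open>z x = y z\<close>.\<close>

lemma central_imp_class_function:
  assumes "group G" and fin: "finite (carrier G)" and f: "f \<in> centre (group_algebra G)"
    and car: "x \<in> carrier G" "y \<in> carrier G" "z \<in> carrier G" and conj: "z \<otimes>\<^bsub>G\<^esub> x = y \<otimes>\<^bsub>G\<^esub> z"
  shows "f y = f x"
proof -
  interpret G: group G by fact
  let ?e = "\<lambda>u. of_bool (u = z) :: complex"
  have "?e \<in> carrier (group_algebra G)"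
    using car by (auto simp: group_algebra_carrier)
  then have "(f \<otimes>\<^bsub>group_algebra G\<^esub> ?e) (y \<otimes>\<^bsub>G\<^esub> z) = (?e \<otimes>\<^bsub>group_algebra G\<^esub> f) (z \<otimes>\<^bsub>G\<^esub> x)"
    using f conj by (simp add: centre_def)
  moreover have "(f \<otimes>\<^bsub>group_algebra G\<^esub> ?e) (y \<otimes>\<^bsub>G\<^esub> z) = f y"
    using car fin by (simp add: group_algebra_mult_right[OF \<open>group G\<close>] of_bool_def
        if_distrib[of "\<lambda>t. _ * t"] sum.delta G.m_assoc cong: if_cong)
  moreover have "(?e \<otimes>\<^bsub>group_algebra G\<^esub> f) (z \<otimes>\<^bsub>G\<^esub> x) = f x"
    using car fin by (simp add: group_algebra_mult_left[OF \<open>group G\<close>] of_bool_def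
        if_distrib[of "\<lambda>t. t * _"] sum.delta G.m_assoc[symmetric] cong: if_cong)
  ultimately show ?thesis by simp
qed

lemma class_function_imp_central:
  assumes "group G" and fin: "finite (carrier G)" and f: "f \<in> carrier (group_algebra G)"
    and class_fun: "\<And>x y z. x \<in> carrier G \<Longrightarrow> y \<in> carrier G \<Longrightarrow> z \<in> carrier G \<Longrightarrow>
      z \<otimes>\<^bsub>G\<^esub> x = y \<otimes>\<^bsub>G\<^esub> z \<Longrightarrow> f y = f x"
  shows "f \<in> centre (group_algebra G)"
proof -
  interpret G: group G by fact
  interpret A: ring "group_algebra G" using ring_group_algebra[OF assms(1,2)] .
  have "f \<otimes>\<^bsub>group_algebra G\<^esub> g = g \<otimes>\<^bsub>group_algebra G\<^esub> f" if g: "g \<in> carrier (group_algebra G)" for g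
  proof
    fix x
    show "(f \<otimes>\<^bsub>group_algebra G\<^esub> g) x = (g \<otimes>\<^bsub>group_algebra G\<^esub> f) x"
    proof (cases "x \<in> carrier G")
      case True
      have "f (x \<otimes>\<^bsub>G\<^esub> inv\<^bsub>G\<^esub> z) = f (inv\<^bsub>G\<^esub> z \<otimes>\<^bsub>G\<^esub> x)" if "z \<in> carrier G" for z
      proof (rule class_fun[of "inv\<^bsub>G\<^esub> z \<otimes>\<^bsub>G\<^esub> x" _ z])
        have "z \<otimes>\<^bsub>G\<^esub> (inv\<^bsub>G\<^esub> z \<otimes>\<^bsub>G\<^esub> x) = x"
          using True that by (simp flip: G.m_assoc)
        moreover have "(x \<otimes>\<^bsub>G\<^esub> inv\<^bsub>G\<^esub> z) \<otimes>\<^bsub>G\<^esub> z = x"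
          using True that by (simp add: G.m_assoc)
        ultimately show "z \<otimes>\<^bsub>G\<^esub> (inv\<^bsub>G\<^esub> z \<otimes>\<^bsub>G\<^esub> x) = (x \<otimes>\<^bsub>G\<^esub> inv\<^bsub>G\<^esub> z) \<otimes>\<^bsub>G\<^esub> z"
          by simp
      qed (use True that in auto)
      with True show ?thesis
        by (simp add: group_algebra_mult_right[OF \<open>group G\<close> fin, of x f g]
            group_algebra_mult_left[OF \<open>group G\<close> fin, of x g f] mult.commute cong: sum.cong)
    next
      case False
      then show ?thesis
        using A.m_closed[OF f g] A.m_closed[OF g f] by (simp add: group_algebra_carrier)
    qed
  qed
  with f show ?thesis by (simp add: centre_def)
qed

lemma finite_sym_group: "finite (carrier (sym_group n))"
  by (simp add: sym_group_def finite_permutations)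

lemma ring_sym_algebra: "ring (sym_algebra n)"
  by (rule ring_group_algebra[OF sym_group_is_group finite_sym_group])

lemma sym_algebra_carrier: "f \<in> carrier (sym_algebra n) \<longleftrightarrow> (\<forall>\<sigma>. \<not> \<sigma> permutes {1..n} \<longrightarrow> f \<sigma> = 0)"
  by (simp add: group_algebra_carrier sym_group_carrier)

lemma sym_algebra_add: "(f \<oplus>\<^bsub>sym_algebra n\<^esub> g) \<sigma> = f \<sigma> + g \<sigma>"
  by (simp add: group_algebra_def)

lemma sym_algebra_one: "\<one>\<^bsub>sym_algebra n\<^esub> \<sigma> = of_bool (\<sigma> = id)"
  by (simp add: group_algebra_def sym_group_one)

lemma sym_algebra_zero: "\<zero>\<^bsub>sym_algebra n\<^esub> \<sigma> = 0"
  by (simp add: group_algebra_def)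

lemma permutes_transpose_comp_iff:
  assumes "k \<in> A" "m \<in> A"
  shows "\<sigma> \<circ> Transposition.transpose k m permutes A \<longleftrightarrow> \<sigma> permutes A"
    and "Transposition.transpose k m \<circ> \<sigma> permutes A \<longleftrightarrow> \<sigma> permutes A"
proof -
  let ?t = "Transposition.transpose k m"
  have t: "?t permutes A" using assms by (rule permutes_swap_id)
  have "\<sigma> = (\<sigma> \<circ> ?t) \<circ> ?t" "\<sigma> = ?t \<circ> (?t \<circ> \<sigma>)"
    by (simp_all add: fun_eq_iff)
  then show "\<sigma> \<circ> ?t permutes A \<longleftrightarrow> \<sigma> permutes A" "?t \<circ> \<sigma> permutes A \<longleftrightarrow> \<sigma> permutes A"
    using permutes_compose[OF t] permutes_compose[OF _ t] by metis+
qed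

lemma sym_group_inv_transpose:
  assumes "k \<in> {1..n}" "m \<in> {1..n}"
  shows "inv\<^bsub>sym_group n\<^esub> (Transposition.transpose k m) = Transposition.transpose k m"
  by (rule group.inv_equality[OF sym_group_is_group])
    (use assms in \<open>auto intro!: permutes_swap_id simp: sym_group_mult sym_group_one sym_group_carrier fun_eq_iff\<close>)

definition shifted_jucys_murphy :: "complex \<Rightarrow> nat \<Rightarrow> (nat \<Rightarrow> nat) \<Rightarrow> complex" where
  "shifted_jucys_murphy c m = (\<lambda>\<sigma>. c * of_bool (\<sigma> = id) + jucys_murphy m \<sigma>)"

lemma shifted_jucys_murphy_carrier:
  assumes "m \<le> n" shows "shifted_jucys_murphy c m \<in> carrier (sym_algebra n)"
proof -
  have "Transposition.transpose k m permutes {1..n}" if "k \<in> {1..<m}" for k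
    using that assms by (intro permutes_swap_id) auto
  then show ?thesis
    by (auto simp: sym_algebra_carrier shifted_jucys_murphy_def jucys_murphy_def permutes_id
        intro!: sum.neutral)
qed

text \<open>Transpositions are involutions, so convolution with $c + J_m$ needs no inverses. In this form the
  recurrences below become products in the group algebra.\<close>

lemma mult_shifted_jucys_murphy:
  assumes m: "m \<le> n" and f: "f \<in> carrier (sym_algebra n)"
  shows "(f \<otimes>\<^bsub>sym_algebra n\<^esub> shifted_jucys_murphy c m) \<sigma> =
      c * f \<sigma> + (\<Sum>k\<in>{1..<m}. f (\<sigma> \<circ> Transposition.transpose k m))" (is ?right)
    and "(shifted_jucys_murphy c m \<otimes>\<^bsub>sym_algebra n\<^esub> f) \<sigma> =
      c * f \<sigma> + (\<Sum>k\<in>{1..<m}. f (Transposition.transpose k m \<circ> \<sigma>))" (is ?left)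
proof -
  interpret A: ring "sym_algebra n" by (rule ring_sym_algebra)
  interpret G: group "sym_group n" by (rule sym_group_is_group)
  let ?C = "carrier (sym_group n)"
  note carrier = shifted_jucys_murphy_carrier[OF m, of c]
  have t_in: "Transposition.transpose k m \<in> ?C" if "k \<in> {1..<m}" for k
    using that m by (auto simp: sym_group_carrier intro!: permutes_swap_id)
  have inv_t: "inv\<^bsub>sym_group n\<^esub> (Transposition.transpose k m) = Transposition.transpose k m" if "k \<in> {1..<m}" for k
    using that m by (intro sym_group_inv_transpose) auto
  have inv_id: "inv\<^bsub>sym_group n\<^esub> id = id"
    using G.inv_one by (simp add: sym_group_one)
  have id_in: "id \<in> ?C"
    by (simp add: sym_group_carrier permutes_id)
  have pair: "(\<Sum>z\<in>?C. h z * shifted_jucys_murphy c m z) = c * h id + (\<Sum>k\<in>{1..<m}. h (Transposition.transpose k m))"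
    for h :: "(nat \<Rightarrow> nat) \<Rightarrow> complex"
  proof -
    have "(\<Sum>z\<in>?C. h z * shifted_jucys_murphy c m z) =
        (\<Sum>z\<in>?C. if z = id then c * h z else 0) +
        (\<Sum>z\<in>?C. \<Sum>k\<in>{1..<m}. if z = Transposition.transpose k m then h z else 0)"
      by (simp add: shifted_jucys_murphy_def jucys_murphy_def distrib_left sum.distrib sum_distrib_left
          of_bool_def if_distrib[of "\<lambda>t. _ * t"] mult.commute cong: if_cong)
    also have "(\<Sum>z\<in>?C. \<Sum>k\<in>{1..<m}. if z = Transposition.transpose k m then h z else 0) =
        (\<Sum>k\<in>{1..<m}. \<Sum>z\<in>?C. if z = Transposition.transpose k m then h z else 0)"
      by (rule sum.swap)
    also have "\<dots> = (\<Sum>k\<in>{1..<m}. h (Transposition.transpose k m))"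
      by (rule sum.cong[OF refl]) (simp add: sum.delta finite_sym_group t_in)
    also have "(\<Sum>z\<in>?C. if z = id then c * h z else 0) = c * h id"
      by (subst sum.delta[OF finite_sym_group]) (simp only: id_in if_True)
    finally show ?thesis .
  qed
  show ?right
  proof (cases "\<sigma> \<in> ?C")
    case True
    then show ?thesis
      by (simp add: group_algebra_mult_right[OF sym_group_is_group finite_sym_group] pair inv_t inv_id
          sym_group_mult cong: sum.cong)
  next
    case False
    then have "f (\<sigma> \<circ> Transposition.transpose k m) = 0" if "k \<in> {1..<m}" for k
      using f that m permutes_transpose_comp_iff(1)[of k "{1..n}" m \<sigma>]
      by (auto simp: sym_algebra_carrier sym_group_carrier)
    with False f A.m_closed[OF f carrier] show ?thesis
      by (simp add: group_algebra_carrier)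
  qed
  show ?left
  proof (cases "\<sigma> \<in> ?C")
    case True
    then show ?thesis
      by (simp add: group_algebra_mult_left[OF sym_group_is_group finite_sym_group] pair inv_t inv_id
          sym_group_mult mult.commute[of "shifted_jucys_murphy _ _ _"] cong: sum.cong)
  next
    case False
    then have "f (Transposition.transpose k m \<circ> \<sigma>) = 0" if "k \<in> {1..<m}" for k
      using f that m permutes_transpose_comp_iff(2)[of k "{1..n}" m \<sigma>]
      by (auto simp: sym_algebra_carrier sym_group_carrier)
    with False f A.m_closed[OF carrier f] show ?thesis
      by (simp add: group_algebra_carrier)
  qed
qed

section \<open>The character of the symmetric group on tensor powers\<close>

definition invariant_colourings :: "nat \<Rightarrow> nat \<Rightarrow> (nat \<Rightarrow> nat) \<Rightarrow> (nat \<Rightarrow> nat) set" where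
  "invariant_colourings d m \<sigma> = {f \<in> {1..m} \<rightarrow>\<^sub>E {..<d}. \<forall>i\<in>{1..m}. f (\<sigma> i) = f i}"

text \<open>A colouring is invariant under \<open>\<sigma>\<close> iff it is constant on the cycles of \<open>\<sigma>\<close>. The number of
  such colourings is thus $d^{\,\mathrm{cycles}(\sigma)}$, the character of $S(m)$ on $(\mathbb{C}^d)^{\otimes m}$. Counting
  colourings makes both conjugation invariance and the recurrence in \<open>m\<close> bijective statements that never
  mention how a transposition merges or splits cycles.\<close>

definition tensor_character :: "nat \<Rightarrow> nat \<Rightarrow> (nat \<Rightarrow> nat) \<Rightarrow> complex" where
  "tensor_character d m = (\<lambda>\<sigma>. if \<sigma> permutes {1..m} then of_nat (card (invariant_colourings d m \<sigma>)) else 0)"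

lemma invariant_colourings_iff:
  "f \<in> invariant_colourings d m \<sigma> \<longleftrightarrow>
    (\<forall>i\<in>{1..m}. f i < d \<and> f (\<sigma> i) = f i) \<and> (\<forall>i. i \<notin> {1..m} \<longrightarrow> f i = undefined)"
  unfolding invariant_colourings_def PiE_def extensional_def Pi_def by blast

lemma atLeast_1_atMost_Suc_iff: "i \<in> {1..Suc l} \<longleftrightarrow> i = Suc l \<or> i \<in> {1..l}"
  by auto

lemma card_invariant_colourings_fixed:
  assumes \<sigma>: "\<sigma> permutes {1..l}"
  shows "card (invariant_colourings d (Suc l) \<sigma>) = d * card (invariant_colourings d l \<sigma>)"
proof -
  have in_l: "\<sigma> i \<in> {1..l}" if "i \<in> {1..l}" for i
    using permutes_in_image[OF \<sigma>] that by blast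
  have fixed: "\<sigma> (Suc l) = Suc l"
    by (rule permutes_not_in[OF \<sigma>]) simp
  have notin: "Suc l \<notin> {1..l}" by simp
  have "bij_betw (\<lambda>(c, f). f(Suc l := c)) ({..<d} \<times> invariant_colourings d l \<sigma>) (invariant_colourings d (Suc l) \<sigma>)"
  proof (rule bij_betw_byWitness[where f' = "\<lambda>f. (f (Suc l), f(Suc l := undefined))"])
    show "\<forall>p\<in>{..<d} \<times> invariant_colourings d l \<sigma>.
        (\<lambda>f. (f (Suc l), f(Suc l := undefined))) ((\<lambda>(c, f). f(Suc l := c)) p) = p"
    proof
      fix p assume "p \<in> {..<d} \<times> invariant_colourings d l \<sigma>"
      then have "snd p \<in> invariant_colourings d l \<sigma>"
        by auto
      then have "snd p (Suc l) = undefined"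
        using notin unfolding invariant_colourings_iff by blast
      then show "(\<lambda>f. (f (Suc l), f(Suc l := undefined))) ((\<lambda>(c, f). f(Suc l := c)) p) = p"
        by (cases p) (simp add: fun_upd_idem)
    qed
    show "\<forall>f\<in>invariant_colourings d (Suc l) \<sigma>.
        (\<lambda>(c, f). f(Suc l := c)) (f (Suc l), f(Suc l := undefined)) = f"
      by simp
    have "f(Suc l := c) \<in> invariant_colourings d (Suc l) \<sigma>" if "c < d" "f \<in> invariant_colourings d l \<sigma>" for c f
      using that fixed in_l notin unfolding invariant_colourings_iff Ball_def atLeast_1_atMost_Suc_iff
      by (metis fun_upd_apply)
    then show "(\<lambda>(c, f). f(Suc l := c)) ` ({..<d} \<times> invariant_colourings d l \<sigma>) \<subseteq> invariant_colourings d (Suc l) \<sigma>"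
      by auto
    have "f(Suc l := undefined) \<in> invariant_colourings d l \<sigma> \<and> f (Suc l) < d"
      if "f \<in> invariant_colourings d (Suc l) \<sigma>" for f
      using that in_l notin unfolding invariant_colourings_iff Ball_def atLeast_1_atMost_Suc_iff
      by (metis fun_upd_apply)
    then show "(\<lambda>f. (f (Suc l), f(Suc l := undefined))) ` invariant_colourings d (Suc l) \<sigma>
        \<subseteq> {..<d} \<times> invariant_colourings d l \<sigma>"
      by auto
  qed
  from bij_betw_same_card[OF this] show ?thesis
    by (simp add: card_cartesian_product)
qed

text \<open>Composing with the transposition cuts \<open>Suc l\<close> out of its cycle. The colour of \<open>Suc l\<close> is forced to be
  that of its successor \<open>j\<close>, so restriction to \<open>{1..l}\<close> loses nothing.\<close>

lemma card_invariant_colourings_moved: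
  assumes \<sigma>: "\<sigma> permutes {1..Suc l}" and j: "\<sigma> (Suc l) = j" "j \<noteq> Suc l"
  shows "card (invariant_colourings d (Suc l) \<sigma>) =
    card (invariant_colourings d l (Transposition.transpose j (Suc l) \<circ> \<sigma>))"
proof -
  define \<rho> where "\<rho> = Transposition.transpose j (Suc l) \<circ> \<sigma>"
  have in_Suc: "\<sigma> i \<in> {1..Suc l}" if "i \<in> {1..Suc l}" for i
    using permutes_in_image[OF \<sigma>] that by blast
  have j_in: "j \<in> {1..l}"
    using in_Suc[of "Suc l"] j by auto
  have notin: "Suc l \<notin> {1..l}" by simp
  have \<sigma>_neq: "\<sigma> i \<noteq> j" if "i \<in> {1..l}" for i
    using that j(1) injD[OF permutes_inj[OF \<sigma>], of i "Suc l"] by auto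
  have \<rho>: "\<rho> i = (if \<sigma> i = Suc l then j else \<sigma> i)" if "i \<in> {1..l}" for i
    using \<sigma>_neq[OF that] by (simp add: \<rho>_def Transposition.transpose_def)
  have "bij_betw (\<lambda>f. f(Suc l := undefined)) (invariant_colourings d (Suc l) \<sigma>) (invariant_colourings d l \<rho>)"
  proof (rule bij_betw_byWitness[where f' = "\<lambda>f. f(Suc l := f j)"])
    have last: "f (Suc l) = f j" if "f \<in> invariant_colourings d (Suc l) \<sigma>" for f
      using that j(1) unfolding invariant_colourings_iff Ball_def atLeast_1_atMost_Suc_iff by metis
    then show "\<forall>f\<in>invariant_colourings d (Suc l) \<sigma>.
        (f(Suc l := undefined)) (Suc l := (f(Suc l := undefined)) j) = f"
      using j(2) by (simp add: fun_upd_idem)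
    show "\<forall>f\<in>invariant_colourings d l \<rho>. (f(Suc l := f j)) (Suc l := undefined) = f"
    proof
      fix f assume "f \<in> invariant_colourings d l \<rho>"
      then have "f (Suc l) = undefined"
        using notin unfolding invariant_colourings_iff by blast
      then show "(f(Suc l := f j)) (Suc l := undefined) = f"
        by (simp add: fun_upd_idem)
    qed
    have "f(Suc l := undefined) \<in> invariant_colourings d l \<rho>"
      if f: "f \<in> invariant_colourings d (Suc l) \<sigma>" for f
    proof -
      have "(f(Suc l := undefined)) (\<rho> i) = f i" if i: "i \<in> {1..l}" for i
      proof -
        have "(f(Suc l := undefined)) (\<rho> i) = f (\<sigma> i)"
          using last[OF f] j(2) unfolding \<rho>[OF i] by auto
        also have "\<dots> = f i"
          using f i unfolding invariant_colourings_iff Ball_def atLeast_1_atMost_Suc_iff by blast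
        finally show ?thesis .
      qed
      with f notin show ?thesis
        unfolding invariant_colourings_iff Ball_def atLeast_1_atMost_Suc_iff by (metis fun_upd_apply)
    qed
    then show "(\<lambda>f. f(Suc l := undefined)) ` invariant_colourings d (Suc l) \<sigma> \<subseteq> invariant_colourings d l \<rho>"
      by blast
    have "f(Suc l := f j) \<in> invariant_colourings d (Suc l) \<sigma>"
      if f: "f \<in> invariant_colourings d l \<rho>" for f
    proof -
      have "(f(Suc l := f j)) (\<sigma> i) = (f(Suc l := f j)) i" if i: "i \<in> {1..Suc l}" for i
      proof (cases "i = Suc l")
        case True
        then show ?thesis using j by auto
      next
        case False
        with i have i: "i \<in> {1..l}" by auto
        have "(f(Suc l := f j)) (\<sigma> i) = f (\<rho> i)"
          unfolding \<rho>[OF i] by auto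
        also have "\<dots> = f i"
          using f i unfolding invariant_colourings_iff by blast
        finally show ?thesis using False by simp
      qed
      with f j_in show ?thesis
        unfolding invariant_colourings_iff Ball_def atLeast_1_atMost_Suc_iff by (metis fun_upd_apply)
    qed
    then show "(\<lambda>f. f(Suc l := f j)) ` invariant_colourings d l \<rho> \<subseteq> invariant_colourings d (Suc l) \<sigma>"
      by blast
  qed
  from bij_betw_same_card[OF this] show ?thesis
    by (simp only: \<rho>_def)
qed

lemma permutes_initial_segment_iff:
  assumes "\<sigma> permutes {1..Suc l}"
  shows "\<sigma> permutes {1..l} \<longleftrightarrow> \<sigma> (Suc l) = Suc l"
proof
  assume "\<sigma> (Suc l) = Suc l"
  then show "\<sigma> permutes {1..l}"
    by (intro permutes_superset[OF assms]) (auto simp: le_Suc_eq)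
qed (auto intro: permutes_not_in)

text \<open>This says $P_{l+1} = (d + J_{l+1}) P_l$. At each permutation a single term on the left survives: the first one if
  \<open>\<sigma>\<close> fixes \<open>Suc l\<close> (then the colour of \<open>Suc l\<close> is free), and otherwise that of the only
  transposition which restores \<open>Suc l\<close> as a fixed point.\<close>

lemma tensor_character_recurrence:
  "of_nat d * tensor_character d l \<sigma> + (\<Sum>k\<in>{1..<Suc l}. tensor_character d l (Transposition.transpose k (Suc l) \<circ> \<sigma>))
    = tensor_character d (Suc l) \<sigma>"
proof (cases "\<sigma> permutes {1..Suc l}")
  case False
  have "\<not> Transposition.transpose k (Suc l) \<circ> \<sigma> permutes {1..l}" if "k \<in> {1..<Suc l}" for k
    using False that permutes_transpose_comp_iff(2)[of k "{1..Suc l}" "Suc l" \<sigma>]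
      permutes_subset[of "Transposition.transpose k (Suc l) \<circ> \<sigma>" "{1..l}" "{1..Suc l}"] by auto
  moreover have "\<not> \<sigma> permutes {1..l}"
    using False permutes_subset[of \<sigma> "{1..l}" "{1..Suc l}"] by auto
  ultimately show ?thesis
    using False by (simp add: tensor_character_def)
next
  case True
  define j where "j = \<sigma> (Suc l)"
  have j: "j \<in> {1..Suc l}"
    unfolding j_def using permutes_in_image[OF True, of "Suc l"] by simp
  have iff: "Transposition.transpose k (Suc l) \<circ> \<sigma> permutes {1..l} \<longleftrightarrow> k = j" if "k \<in> {1..<Suc l}" for k
  proof -
    have "Transposition.transpose k (Suc l) \<circ> \<sigma> permutes {1..Suc l}"
      using True that permutes_transpose_comp_iff(2)[of k "{1..Suc l}" "Suc l" \<sigma>] by auto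
    then show ?thesis
      using that by (subst permutes_initial_segment_iff) (auto simp: j_def Transposition.transpose_def)
  qed
  have "(\<Sum>k\<in>{1..<Suc l}. tensor_character d l (Transposition.transpose k (Suc l) \<circ> \<sigma>)) =
      (\<Sum>k\<in>{1..<Suc l}. if k = j then
        of_nat (card (invariant_colourings d l (Transposition.transpose j (Suc l) \<circ> \<sigma>))) else 0)"
    by (rule sum.cong[OF refl]) (simp only: tensor_character_def iff split: if_split, simp)
  also have "\<dots> = (if j = Suc l then 0 else
      of_nat (card (invariant_colourings d l (Transposition.transpose j (Suc l) \<circ> \<sigma>))))"
    using j by auto
  finally have sum_eq: "(\<Sum>k\<in>{1..<Suc l}. tensor_character d l (Transposition.transpose k (Suc l) \<circ> \<sigma>)) = \<dots>" .
  show ?thesis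
  proof (cases "j = Suc l")
    case fixed: True
    then have \<sigma>: "\<sigma> permutes {1..l}"
      using permutes_initial_segment_iff[OF True] by (simp add: j_def)
    show ?thesis
      unfolding sum_eq using fixed True \<sigma> card_invariant_colourings_fixed[OF \<sigma>, of d]
      by (simp add: tensor_character_def)
  next
    case moved: False
    then have "\<not> \<sigma> permutes {1..l}"
      using permutes_initial_segment_iff[OF True] by (simp add: j_def)
    then show ?thesis
      unfolding sum_eq using moved True card_invariant_colourings_moved[OF True, of j d]
      by (simp add: tensor_character_def j_def)
  qed
qed

lemma tensor_character_carrier:
  assumes "m \<le> n" shows "tensor_character d m \<in> carrier (sym_algebra n)"
  using assms permutes_subset[of _ "{1..m}" "{1..n}"] by (auto simp: sym_algebra_carrier tensor_character_def)

lemma tensor_character_central: "tensor_character d n \<in> centre (sym_algebra n)"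
proof (rule class_function_imp_central[OF sym_group_is_group finite_sym_group tensor_character_carrier[OF order_refl]])
  fix \<sigma> \<rho> \<pi>
  assume "\<sigma> \<in> carrier (sym_group n)" "\<rho> \<in> carrier (sym_group n)" "\<pi> \<in> carrier (sym_group n)"
    and "\<pi> \<otimes>\<^bsub>sym_group n\<^esub> \<sigma> = \<rho> \<otimes>\<^bsub>sym_group n\<^esub> \<pi>"
  then have perms: "\<sigma> permutes {1..n}" "\<rho> permutes {1..n}" and \<pi>: "\<pi> permutes {1..n}"
    and conj: "\<pi> (\<sigma> i) = \<rho> (\<pi> i)" for i
    by (auto simp: sym_group_carrier sym_group_mult fun_eq_iff)
  note inv_\<pi> = permutes_inv[OF \<pi>]
  have conj': "inv' \<pi> (\<rho> i) = \<sigma> (inv' \<pi> i)" for i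
    using conj[of "inv' \<pi> i"] permutes_inverses[OF \<pi>] by metis
  have comp: "f \<circ> \<theta> \<in> {1..n} \<rightarrow>\<^sub>E {..<d}" if "f \<in> {1..n} \<rightarrow>\<^sub>E {..<d}" and "\<theta> permutes {1..n}" for f \<theta>
    using that permutes_in_image[OF that(2)] permutes_not_in[OF that(2)]
    by (auto simp: PiE_def extensional_def Pi_def)
  have "bij_betw (\<lambda>f. f \<circ> \<pi>) (invariant_colourings d n \<rho>) (invariant_colourings d n \<sigma>)"
  proof (rule bij_betw_byWitness[where f' = "\<lambda>f. f \<circ> inv' \<pi>"])
    show "(\<lambda>f. f \<circ> \<pi>) ` invariant_colourings d n \<rho> \<subseteq> invariant_colourings d n \<sigma>"
      using comp[OF _ \<pi>] permutes_in_image[OF \<pi>] unfolding invariant_colourings_def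
      by (auto simp: conj simp del: atLeastAtMost_iff)
    show "(\<lambda>f. f \<circ> inv' \<pi>) ` invariant_colourings d n \<sigma> \<subseteq> invariant_colourings d n \<rho>"
      using comp[OF _ inv_\<pi>] permutes_in_image[OF inv_\<pi>] unfolding invariant_colourings_def
      by (auto simp: conj' simp del: atLeastAtMost_iff)
  qed (auto simp: fun_eq_iff permutes_inverses[OF \<pi>])
  then show "tensor_character d n \<rho> = tensor_character d n \<sigma>"
    using perms by (simp add: tensor_character_def bij_betw_same_card)
qed

section \<open>Complete homogeneous symmetric functions\<close>

lemma (in ring) foldr_mult_closed:
  assumes "\<And>i. i \<in> set is \<Longrightarrow> x i \<in> carrier R" "z \<in> carrier R"
  shows "foldr (\<lambda>i y. x i \<otimes> y) is z \<in> carrier R"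
  using assms by (induction "is") auto

lemma (in ring) foldr_mult_snoc:
  assumes "\<And>i. i \<in> set is \<Longrightarrow> x i \<in> carrier R" "z \<in> carrier R"
  shows "foldr (\<lambda>i y. x i \<otimes> y) is z = foldr (\<lambda>i y. x i \<otimes> y) is \<one> \<otimes> z"
  using assms by (induction "is") (auto simp: m_assoc foldr_mult_closed)

lemma sorted_lists_snoc_decomp:
  "{is. length is = Suc r \<and> sorted is \<and> set is \<subseteq> {1..Suc m}} =
     {is. length is = Suc r \<and> sorted is \<and> set is \<subseteq> {1..m}} \<union>
     (\<lambda>is. is @ [Suc m]) ` {is. length is = r \<and> sorted is \<and> set is \<subseteq> {1..Suc m}}" (is "?L = ?A \<union> ?B")
proof
  show "?L \<subseteq> ?A \<union> ?B"
  proof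
    fix "is" assume "is": "is \<in> ?L"
    then obtain js k where js: "is = js @ [k]" by (cases "is" rule: rev_cases) auto
    show "is \<in> ?A \<union> ?B"
    proof (cases "k = Suc m")
      case True
      then show ?thesis using "is" js by (auto simp: sorted_append)
    next
      case False
      then have "set is \<subseteq> {1..m}"
        using "is" js by (fastforce simp: sorted_append)
      then show ?thesis using "is" by auto
    qed
  qed
  show "?A \<union> ?B \<subseteq> ?L"
    by (fastforce simp: sorted_append)
qed

lemma finite_sorted_lists: "finite {is. length is = r \<and> sorted is \<and> set is \<subseteq> {1..m::nat}}"
  by (rule finite_subset[OF _ finite_lists_length_eq[of "{1..m}" r]]) auto

context ring
begin

lemma complete_homogeneous_closed:
  assumes "\<And>i. i \<in> {1..m} \<Longrightarrow> x i \<in> carrier R"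
  shows "complete_homogeneous R m r x \<in> carrier R"
  unfolding complete_homogeneous_def using assms by (intro finsum_closed) (auto intro!: foldr_mult_closed)

lemma complete_homogeneous_0_right: "complete_homogeneous R m 0 x = \<one>"
proof -
  have "{is. length is = 0 \<and> sorted is \<and> set is \<subseteq> {1..m}} = {[]}" by auto
  then show ?thesis by (simp add: complete_homogeneous_def)
qed

lemma complete_homogeneous_0_left: "complete_homogeneous R 0 (Suc r) x = \<zero>"
proof -
  have empty: "{is. length is = Suc r \<and> sorted is \<and> set is \<subseteq> {1..0::nat}} = {}" by auto
  show ?thesis unfolding complete_homogeneous_def empty by simp
qed

text \<open>A weakly increasing sequence of indices up to \<open>Suc m\<close> either avoids \<open>Suc m\<close> or ends with it. As
  \<open>x (Suc m)\<close> then is the last factor, the elements need not commute.\<close>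

lemma complete_homogeneous_Suc:
  assumes x: "\<And>i. i \<in> {1..Suc m} \<Longrightarrow> x i \<in> carrier R"
  shows "complete_homogeneous R (Suc m) (Suc r) x =
    complete_homogeneous R m (Suc r) x \<oplus> complete_homogeneous R (Suc m) r x \<otimes> x (Suc m)"
proof -
  let ?L = "\<lambda>m r. {is. length is = r \<and> sorted is \<and> set is \<subseteq> {1..m}}"
  let ?p = "\<lambda>is. foldr (\<lambda>i y. x i \<otimes> y) is \<one>"
  have closed: "?p is \<in> carrier R" if "set is \<subseteq> {1..Suc m}" for "is"
    using x that by (intro foldr_mult_closed) auto
  have p_snoc: "?p (is @ [Suc m]) = ?p is \<otimes> x (Suc m)" if "set is \<subseteq> {1..Suc m}" for "is"
  proof -
    have "x i \<in> carrier R" if "i \<in> set is" for i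
      using x that \<open>set is \<subseteq> {1..Suc m}\<close> by blast
    from foldr_mult_snoc[OF this, where z = "x (Suc m)"] show ?thesis
      using x[of "Suc m"] by simp
  qed
  have inj: "inj_on (\<lambda>is. is @ [Suc m]) (?L (Suc m) r)"
    by (auto simp: inj_on_def)
  have "complete_homogeneous R (Suc m) (Suc r) x =
      (\<Oplus>is\<in>?L m (Suc r) \<union> (\<lambda>is. is @ [Suc m]) ` ?L (Suc m) r. ?p is)"
    unfolding complete_homogeneous_def sorted_lists_snoc_decomp ..
  also have "\<dots> = (\<Oplus>is\<in>?L m (Suc r). ?p is) \<oplus> (\<Oplus>is\<in>(\<lambda>is. is @ [Suc m]) ` ?L (Suc m) r. ?p is)"
  proof (rule finsum_Un_disjoint)
    show "?L m (Suc r) \<inter> (\<lambda>is. is @ [Suc m]) ` ?L (Suc m) r = {}"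
      by auto
    show "?p \<in> ?L m (Suc r) \<rightarrow> carrier R" "?p \<in> (\<lambda>is. is @ [Suc m]) ` ?L (Suc m) r \<rightarrow> carrier R"
      by (rule Pi_I, rule closed, force)+
  qed (use finite_sorted_lists in auto)
  also have "(\<Oplus>is\<in>(\<lambda>is. is @ [Suc m]) ` ?L (Suc m) r. ?p is) = (\<Oplus>is\<in>?L (Suc m) r. ?p (is @ [Suc m]))"
    by (rule finsum_reindex[OF _ inj]) (rule Pi_I, rule closed, force)
  also have "\<dots> = (\<Oplus>is\<in>?L (Suc m) r. ?p is \<otimes> x (Suc m))"
    by (rule finsum_cong') (use p_snoc closed x in auto)
  also have "\<dots> = (\<Oplus>is\<in>?L (Suc m) r. ?p is) \<otimes> x (Suc m)"
    by (rule finsum_ldistr[symmetric]) (use finite_sorted_lists closed x in auto)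
  finally show ?thesis
    by (simp only: complete_homogeneous_def)
qed

end

section \<open>Uniqueness of expansions in inverse powers\<close>

text \<open>Inductively, if the coefficients below \<open>m\<close> vanish then the power series that starts with \<open>a m\<close> is zero at
  all points \<open>1/d\<close>. These accumulate at 0, where the series is continuous.\<close>

lemma inverse_power_series_unique:
  fixes b :: "nat \<Rightarrow> complex"
  assumes b: "\<And>d::nat. d \<ge> N \<Longrightarrow> (\<lambda>r. b r / of_nat d ^ r) sums s"
  shows "b r = (if r = 0 then s else 0)"
proof -
  define a where "a r = b r - (if r = 0 then s else 0)" for r
  define N' where "N' = max N 1"
  have a_sums: "(\<lambda>r. a r * (1 / of_nat d) ^ r) sums 0" if "d \<ge> N'" for d
  proof -
    have "(\<lambda>r. b r / of_nat d ^ r - (if r = 0 then s else 0)) sums (s - s)"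
      using that by (intro sums_diff b sums_single[of 0 "\<lambda>_. s", simplified]) (simp add: N'_def)
    moreover have "b r / of_nat d ^ r - (if r = 0 then s else 0) = a r * (1 / of_nat d) ^ r" for r
      by (simp add: a_def power_divide)
    ultimately show ?thesis by simp
  qed
  have "a r = 0" for r
  proof (induction r rule: less_induct)
    case (less m)
    define f where "f x = (\<Sum>r. a (r + m) * x ^ r)" for x :: complex
    have tail: "(\<lambda>r. a (r + m) * (1 / of_nat d) ^ r) sums 0" if "d \<ge> N'" for d
    proof -
      have "(\<lambda>r. a (r + m) * (1 / of_nat d) ^ (r + m)) sums (0 - (\<Sum>i<m. a i * (1 / of_nat d) ^ i))"
        using sums_split_initial_segment[OF a_sums[OF that], of m] by simp
      then have "(\<lambda>r. a (r + m) * (1 / of_nat d) ^ (r + m)) sums 0"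
        by (simp add: less.IH)
      then have "(\<lambda>r. of_nat d ^ m * (a (r + m) * (1 / of_nat d) ^ (r + m))) sums (of_nat d ^ m * 0)"
        by (rule sums_mult)
      moreover have "of_nat d ^ m * (a (r + m) * (1 / of_nat d) ^ (r + m)) = a (r + m) * (1 / of_nat d) ^ r" for r
        using that by (simp add: N'_def power_add power_divide)
      ultimately show ?thesis by simp
    qed
    have "(f \<longlongrightarrow> a (0 + m)) (at 0)"
    proof (rule powser_limit_0[where s = "1 / real N'"])
      fix x :: complex assume "norm x < 1 / real N'"
      moreover have "summable (\<lambda>r. a (r + m) * (1 / of_nat N') ^ r)"
        using tail[OF order_refl] by (rule sums_summable)
      moreover have "norm (1 / of_nat N' :: complex) = 1 / real N'"
        by (simp add: norm_divide)
      ultimately have "summable (\<lambda>r. a (r + m) * x ^ r)"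
        using powser_inside[of "\<lambda>r. a (r + m)" "1 / of_nat N'" x] by presburger
      then show "(\<lambda>r. a (r + m) * x ^ r) sums f x"
        unfolding f_def by (rule summable_sums)
    qed (simp add: N'_def)
    moreover have "filterlim (\<lambda>d. 1 / of_nat d :: complex) (at 0) sequentially"
      unfolding filterlim_at
    proof
      show "eventually (\<lambda>d. 1 / of_nat d \<in> UNIV \<and> 1 / of_nat d \<noteq> (0 :: complex)) sequentially"
        using eventually_gt_at_top[of 0] by (rule eventually_mono) simp
    qed (rule lim_1_over_n)
    ultimately have "(\<lambda>d. f (1 / of_nat d)) \<longlonglongrightarrow> a (0 + m)"
      by (rule filterlim_compose)
    moreover have "(\<lambda>d. f (1 / of_nat d)) \<longlonglongrightarrow> 0"
    proof (rule tendsto_eventually)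
      show "eventually (\<lambda>d. f (1 / of_nat d) = 0) sequentially"
        using eventually_ge_at_top[of N']
        by (rule eventually_mono) (simp add: f_def sums_unique[OF tail, symmetric])
    qed
    ultimately show "a m = 0"
      using LIMSEQ_unique by fastforce
  qed
  then show ?thesis
    by (simp add: a_def)
qed

section \<open>The Weingarten function in the group algebra\<close>

lemma weingarten_carrier:
  assumes "m \<le> n" shows "weingarten m M \<in> carrier (sym_algebra n)"
  using assms permutes_subset[of _ "{1..m}" "{1..n}"] by (auto simp: sym_algebra_carrier weingarten_def)

lemma weingarten_0:
  assumes "normalized_haar d M" shows "weingarten 0 M = (\<lambda>\<sigma>. of_bool (\<sigma> = id))"
proof -
  interpret prob_space M using assms by (simp add: normalized_haar_def)
  show ?thesis
    by (auto simp: weingarten_def fun_eq_iff prob_space)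
qed

lemma weingarten_recurrence_all:
  assumes M: "normalized_haar d M" and l: "Suc l \<le> d"
  shows "of_nat d * weingarten (Suc l) M \<sigma> +
      (\<Sum>k\<in>{1..<Suc l}. weingarten (Suc l) M (\<sigma> \<circ> Transposition.transpose k (Suc l))) = weingarten l M \<sigma>"
proof (cases "\<sigma> permutes {1..Suc l}")
  case True
  then show ?thesis
    using weingarten_recurrence[OF M _ l True] by simp
next
  case False
  have "\<not> \<sigma> \<circ> Transposition.transpose k (Suc l) permutes {1..Suc l}" if "k \<in> {1..<Suc l}" for k
    using False that permutes_transpose_comp_iff(1)[of k "{1..Suc l}" "Suc l" \<sigma>] by auto
  moreover have "\<not> \<sigma> permutes {1..l}"
    using False permutes_subset[of \<sigma> "{1..l}" "{1..Suc l}"] by auto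
  ultimately show ?thesis
    using False by (simp add: weingarten_def)
qed

text \<open>The recurrences of the two factors fit together:
  $\mathrm{Wg}_m P_m = \mathrm{Wg}_m (d + J_m) P_{m-1} = \mathrm{Wg}_{m-1} P_{m-1}$, down to $\mathrm{Wg}_0 P_0 = 1$.\<close>

lemma weingarten_mult_tensor_character:
  assumes M: "normalized_haar d M" and "m \<le> n" "m \<le> d"
  shows "weingarten m M \<otimes>\<^bsub>sym_algebra n\<^esub> tensor_character d m = \<one>\<^bsub>sym_algebra n\<^esub>"
  using assms(2,3)
proof (induction m)
  case 0
  interpret A: ring "sym_algebra n" by (rule ring_sym_algebra)
  have "invariant_colourings d 0 \<sigma> = {\<lambda>_. undefined}" for \<sigma>
    by (auto simp: invariant_colourings_iff fun_eq_iff)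
  then have "weingarten 0 M = \<one>\<^bsub>sym_algebra n\<^esub>" "tensor_character d 0 = \<one>\<^bsub>sym_algebra n\<^esub>"
    by (auto simp: weingarten_0[OF M] fun_eq_iff sym_algebra_one tensor_character_def)
  then show ?case by simp
next
  case (Suc l)
  interpret A: ring "sym_algebra n" by (rule ring_sym_algebra)
  let ?E = "shifted_jucys_murphy (of_nat d) (Suc l)"
  have car: "weingarten (Suc l) M \<in> carrier (sym_algebra n)" "?E \<in> carrier (sym_algebra n)"
      "tensor_character d l \<in> carrier (sym_algebra n)"
    using Suc.prems by (auto intro: weingarten_carrier shifted_jucys_murphy_carrier tensor_character_carrier)
  have "tensor_character d (Suc l) = ?E \<otimes>\<^bsub>sym_algebra n\<^esub> tensor_character d l"
    by (rule ext) (simp only: mult_shifted_jucys_murphy(2)[OF Suc.prems(1) car(3)] tensor_character_recurrence)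
  moreover have "weingarten (Suc l) M \<otimes>\<^bsub>sym_algebra n\<^esub> ?E = weingarten l M"
    by (rule ext) (simp only: mult_shifted_jucys_murphy(1)[OF Suc.prems(1) car(1)] weingarten_recurrence_all[OF M Suc.prems(2)])
  ultimately have "weingarten (Suc l) M \<otimes>\<^bsub>sym_algebra n\<^esub> tensor_character d (Suc l) =
      weingarten l M \<otimes>\<^bsub>sym_algebra n\<^esub> tensor_character d l"
    using car by (simp flip: A.m_assoc)
  with Suc show ?case by simp
qed

text \<open>With $g w = w g = 1$ one has $w x = w (x g) w = w (g x) w = x w$.\<close>

lemma (in ring) centre_if_right_inverse_central:
  assumes w: "w \<in> carrier R" and g: "g \<in> centre R" and wg: "w \<otimes> g = \<one>"
  shows "w \<in> centre R"
proof -
  have g_car: "g \<in> carrier R" and gw: "g \<otimes> w = \<one>"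
    using g w wg by (auto simp: centre_def)
  have "w \<otimes> x = x \<otimes> w" if x: "x \<in> carrier R" for x
  proof -
    have "w \<otimes> x = w \<otimes> (x \<otimes> g) \<otimes> w"
      using w x g_car gw by (simp add: m_assoc)
    also have "\<dots> = w \<otimes> (g \<otimes> x) \<otimes> w"
      using g x by (simp add: centre_def)
    also have "\<dots> = x \<otimes> w"
      using w x g_car wg by (simp flip: m_assoc)
    finally show ?thesis .
  qed
  with w show ?thesis by (simp add: centre_def)
qed

lemma weingarten_central:
  assumes "normalized_haar d M" "n \<le> d"
  shows "weingarten n M \<in> centre (sym_algebra n)"
  by (rule ring.centre_if_right_inverse_central[OF ring_sym_algebra weingarten_carrier tensor_character_central
        weingarten_mult_tensor_character[OF assms(1) order_refl assms(2)]]) simp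

section \<open>The coefficients of the expansion\<close>

lemma class_value_central:
  assumes f: "f \<in> centre (sym_algebra n)" and \<sigma>: "\<sigma> permutes {1..n}"
  shows "class_value n f (cycle_type n \<sigma>) = f \<sigma>"
proof -
  define \<tau> where "\<tau> = (SOME \<tau>. \<tau> permutes {1..n} \<and> cycle_type n \<tau> = cycle_type n \<sigma>)"
  have \<tau>: "\<tau> permutes {1..n}" "cycle_type n \<tau> = cycle_type n \<sigma>"
    unfolding \<tau>_def by (rule someI2[of _ \<sigma>]; use \<sigma> in simp)+
  obtain \<pi> where "\<pi> permutes {1..n}" "\<pi> \<circ> \<sigma> = \<tau> \<circ> \<pi>"
    using conjugate_if_cycle_type_eq[OF \<sigma> \<tau>(1)] \<tau>(2) by auto
  then have "f \<tau> = f \<sigma>"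
    using \<sigma> \<tau>(1) by (intro central_imp_class_function[OF sym_group_is_group finite_sym_group f, of \<sigma> \<tau> \<pi>])
      (simp_all add: sym_group_carrier sym_group_mult)
  then show ?thesis by (simp add: class_value_def \<tau>_def)
qed

lemma central_eq_sum_class_sums:
  assumes f: "f \<in> centre (sym_algebra n)"
  shows "(\<Sum>\<mu>\<in>partitions n. class_value n f \<mu> * class_sum n \<mu> \<sigma>) = f \<sigma>"
proof (cases "\<sigma> permutes {1..n}")
  case True
  then have "(\<Sum>\<mu>\<in>partitions n. class_value n f \<mu> * class_sum n \<mu> \<sigma>) =
      (\<Sum>\<mu>\<in>partitions n. if \<mu> = cycle_type n \<sigma> then class_value n f \<mu> else 0)"
    by (intro sum.cong) (auto simp: class_sum_def)
  also have "\<dots> = f \<sigma>"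
    using True by (simp add: finite_partitions cycle_type_in_partitions class_value_central[OF f])
  finally show ?thesis .
next
  case False
  then show ?thesis
    using f by (simp add: class_sum_def centre_def sym_algebra_carrier)
qed

text \<open>Multiplying an expansion of $\mathrm{Wg}_m$ by $d + J_m$ gives the expansion of $\mathrm{Wg}_{m-1}$ with coefficients
  $b'_r = b_r + b_{r-1} J_m$; this is \<open>b'\<close> below. By the induction hypothesis
  $b'_r = (-1)^r h_r(J_1,\dots,J_{m-1})$, and the recurrence for \<open>complete_homogeneous\<close> recovers $b_r$ from
  $b'_r$ by induction on \<open>r\<close>.\<close>

lemma weingarten_coefficients:
  fixes H :: "nat \<Rightarrow> complex mat measure" and b :: "nat \<Rightarrow> (nat \<Rightarrow> nat) \<Rightarrow> complex"
  assumes haar: "\<And>d. d \<ge> n \<Longrightarrow> normalized_haar d (H d)"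
    and "m \<le> n"
    and "\<And>d \<sigma>. d \<ge> n \<Longrightarrow> (\<lambda>r. b r \<sigma> / of_nat d ^ (m + r)) sums weingarten m (H d) \<sigma>"
  shows "b r \<sigma> = (- 1) ^ r * complete_homogeneous (sym_algebra n) m r jucys_murphy \<sigma>"
  using assms(2,3)
proof (induction m arbitrary: b r \<sigma>)
  case 0
  interpret A: ring "sym_algebra n" by (rule ring_sym_algebra)
  have "(\<lambda>r. b r \<sigma> / of_nat d ^ r) sums of_bool (\<sigma> = id)" if "d \<ge> n" for d
    using 0(2)[OF that, of \<sigma>] by (simp add: weingarten_0[OF haar[OF that]])
  then have "b r \<sigma> = (if r = 0 then of_bool (\<sigma> = id) else 0)"
    by (rule inverse_power_series_unique)
  then show ?case
    by (cases r) (simp_all add: A.complete_homogeneous_0_right A.complete_homogeneous_0_left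
        sym_algebra_one sym_algebra_zero)
next
  case (Suc l)
  interpret A: ring "sym_algebra n" by (rule ring_sym_algebra)
  define T where "T f \<sigma> = (\<Sum>k\<in>{1..<Suc l}. f (\<sigma> \<circ> Transposition.transpose k (Suc l)))"
    for f :: "(nat \<Rightarrow> nat) \<Rightarrow> complex" and \<sigma>
  define b' where "b' r \<sigma> = b r \<sigma> + (case r of 0 \<Rightarrow> 0 | Suc s \<Rightarrow> T (b s) \<sigma>)" for r \<sigma>
  let ?h = "\<lambda>m r. complete_homogeneous (sym_algebra n) m r jucys_murphy"
  have J: "jucys_murphy i = shifted_jucys_murphy 0 i" for i
    by (simp add: shifted_jucys_murphy_def)
  have J_car: "jucys_murphy i \<in> carrier (sym_algebra n)" if "i \<in> {1..n}" for i
    using that by (simp add: J shifted_jucys_murphy_carrier)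
  have h_car: "?h (Suc l) r \<in> carrier (sym_algebra n)" for r
    using Suc.prems(1) by (intro A.complete_homogeneous_closed J_car) auto
  have h_Suc: "?h (Suc l) (Suc r) \<sigma> = ?h l (Suc r) \<sigma> + T (?h (Suc l) r) \<sigma>" for r \<sigma>
  proof -
    have "?h (Suc l) (Suc r) = ?h l (Suc r) \<oplus>\<^bsub>sym_algebra n\<^esub> ?h (Suc l) r \<otimes>\<^bsub>sym_algebra n\<^esub> jucys_murphy (Suc l)"
      using Suc.prems(1) by (intro A.complete_homogeneous_Suc J_car) auto
    moreover have "(?h (Suc l) r \<otimes>\<^bsub>sym_algebra n\<^esub> jucys_murphy (Suc l)) \<sigma> = T (?h (Suc l) r) \<sigma>"
      using mult_shifted_jucys_murphy(1)[OF Suc.prems(1) h_car, of r 0 \<sigma>] by (simp only: J T_def) simp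
    ultimately show ?thesis by (simp add: sym_algebra_add)
  qed
  have b': "b' r \<sigma> = (- 1) ^ r * ?h l r \<sigma>" for r \<sigma>
  proof (rule Suc.IH)
    fix d \<sigma> assume d: "d \<ge> n"
    have d_pos: "of_nat d \<noteq> (0 :: complex)"
      using d Suc.prems(1) by simp
    have "(\<lambda>r. of_nat d * (b r \<sigma> / of_nat d ^ (Suc l + r))) sums (of_nat d * weingarten (Suc l) (H d) \<sigma>)"
      by (rule sums_mult[OF Suc.prems(2)[OF d]])
    \<comment> \<open>The factor \<open>d\<close> lowers the exponent by one; in the second series the same is achieved by shifting
      the index, with a zero term in front.\<close>
    then have main: "(\<lambda>r. b r \<sigma> / of_nat d ^ (l + r)) sums (of_nat d * weingarten (Suc l) (H d) \<sigma>)"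
      using d_pos by simp
    have "(\<lambda>s. T (b s) \<sigma> / of_nat d ^ (l + Suc s)) sums T (weingarten (Suc l) (H d)) \<sigma>"
      unfolding T_def sum_divide_distrib
      using Suc.prems(2)[OF d] by (intro sums_sum) simp
    then have "(\<lambda>r. (case r of 0 \<Rightarrow> 0 | Suc s \<Rightarrow> T (b s) \<sigma>) / of_nat d ^ (l + r)) sums T (weingarten (Suc l) (H d)) \<sigma>"
      using sums_Suc[of "\<lambda>r. (case r of 0 \<Rightarrow> 0 | Suc s \<Rightarrow> T (b s) \<sigma>) / of_nat d ^ (l + r)"
          "T (weingarten (Suc l) (H d)) \<sigma>"] by simp
    from sums_add[OF main this]
    show "(\<lambda>r. b' r \<sigma> / of_nat d ^ (l + r)) sums weingarten l (H d) \<sigma>"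
      using weingarten_recurrence_all[OF haar[OF d], of l \<sigma>] d Suc.prems(1)
      by (simp add: b'_def T_def add_divide_distrib)
  qed (use Suc.prems in simp)
  have "b r \<sigma> = (- 1) ^ r * ?h (Suc l) r \<sigma>" for \<sigma>
  proof (induction r arbitrary: \<sigma>)
    case 0
    show ?case
      using b'[of 0 \<sigma>] by (simp add: b'_def A.complete_homogeneous_0_right)
  next
    case (Suc s)
    have "T (b s) \<sigma> = (- 1) ^ s * T (?h (Suc l) s) \<sigma>"
      by (simp only: T_def Suc.IH sum_distrib_left)
    moreover have "b (Suc s) \<sigma> = (- 1) ^ Suc s * ?h l (Suc s) \<sigma> - T (b s) \<sigma>"
      unfolding b'[symmetric] by (simp add: b'_def)
    ultimately show ?case
      by (simp add: h_Suc algebra_simps)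
  qed
  then show ?case .
qed

theorem theorem2p4:
  fixes n :: nat
    and H :: "nat \<Rightarrow> complex mat measure"
    and a :: "nat \<Rightarrow> (nat \<Rightarrow> nat) \<Rightarrow> complex"
  assumes "n \<ge> 1"
    and haar: "\<And>d. d \<ge> n \<Longrightarrow> normalized_haar d (H d)"
    and central: "\<And>r. a r \<in> centre (sym_algebra n)"
    and expansion: "\<And>d \<mu>. d \<ge> n \<Longrightarrow> \<mu> \<in> partitions n \<Longrightarrow>
      (\<lambda>r. class_value n (a r) \<mu> / of_nat d ^ (n + r)) sums class_value n (weingarten n (H d)) \<mu>"
  shows "\<forall>r.
    a r = (\<lambda>\<sigma>. (- 1) ^ r * complete_homogeneous (sym_algebra n) n r jucys_murphy \<sigma>) \<and>
    complete_homogeneous (sym_algebra n) n r jucys_murphy =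
      (\<lambda>\<sigma>. (- 1) ^ r * (\<Sum>\<mu>\<in>partitions n. class_value n (a r) \<mu> * class_sum n \<mu> \<sigma>))"
proof
  fix r
  have sums: "(\<lambda>r. a r \<sigma> / of_nat d ^ (n + r)) sums weingarten n (H d) \<sigma>" if d: "d \<ge> n" for d \<sigma>
  proof (cases "\<sigma> permutes {1..n}")
    case True
    then show ?thesis
      using expansion[OF d cycle_type_in_partitions[OF True]]
      by (simp add: class_value_central central weingarten_central[OF haar[OF d] d])
  next
    case False
    then show ?thesis
      using central by (simp add: weingarten_def centre_def sym_algebra_carrier)
  qed
  have coeff: "a r \<sigma> = (- 1) ^ r * complete_homogeneous (sym_algebra n) n r jucys_murphy \<sigma>" for \<sigma>
    using haar order_refl sums by (rule weingarten_coefficients)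
  have "(- 1) ^ r * a r \<sigma> = complete_homogeneous (sym_algebra n) n r jucys_murphy \<sigma>" for \<sigma>
    by (simp add: coeff flip: mult.assoc power_add mult_2)
  with coeff show "a r = (\<lambda>\<sigma>. (- 1) ^ r * complete_homogeneous (sym_algebra n) n r jucys_murphy \<sigma>) \<and>
    complete_homogeneous (sym_algebra n) n r jucys_murphy =
      (\<lambda>\<sigma>. (- 1) ^ r * (\<Sum>\<mu>\<in>partitions n. class_value n (a r) \<mu> * class_sum n \<mu> \<sigma>))"
    by (simp add: fun_eq_iff central_eq_sum_class_sums[OF central])
qed

end
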